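(* Let $\mathcal H$ be a real Hilbert space with a complex structure $J$. Suppose that $\gamma(t)$ is a smooth curve in $\Lambda_J(\mathcal H)$ and $X(t)$ is a smooth field tangent to $\Lambda_J(\mathcal H)$ along $\gamma(t)$. Then the covariant derivative $\frac{D}{dt}X=\Pi_{\gamma(t)}(\dot X(t))$ of $Gr(\mathcal H)$ satisfies $\frac{D}{dt}X\in (T\Lambda_J(\mathcal H))_{\gamma(t)}$. Moreover, $\Lambda_J(\mathcal H)$ is geodesically convex in the following sense: if $\epsilon_0,\epsilon_1\in\Lambda_J(\mathcal H)$ with $\|\epsilon_0-\epsilon_1\|<2$, then the unique geodesic $\delta(t)=e^{2tz}\epsilon_0$, $t\in[0,1]$, with $\|z\|<\pi/2$, joining $\epsilon_0$ and $\epsilon_1$ in $Gr(\mathcal H)$ lies in $\Lambda_J(\mathcal H)$.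
   Context: $\mathcal H$ is a real Hilbert space (finite or infinite dimensional); $J$ is a bounded operator on $\mathcal H$ with $J^*=-J$ and $J^2=-I$ ($*$ is the transpose). Closed subspaces $S$ are identified with symmetries $\epsilon_S=2p_S-I$ ($p_S$ the orthogonal projection onto $S$). $Gr(\mathcal H)=\{\epsilon\in\mathcal B(\mathcal H):\epsilon^*=\epsilon=\epsilon^{-1}\}$ and $\Lambda_J(\mathcal H)=\{\epsilon\in Gr(\mathcal H):\epsilon J=-J\epsilon\}$ (the Lagrangian subspaces, i.e. those with $J(L)=L^\perp$). Tangent spaces: $(TGr(\mathcal H))_\epsilon=\{x\in\mathcal B(\mathcal H):x^*=x,\ x\epsilon=-\epsilon x\}$ and $(T\Lambda_J(\mathcal H))_\epsilon=\{x\in (TGr(\mathcal H))_\epsilon:xJ=-Jx\}$. The map $\Pi_\epsilon(a)=\frac12(a-\epsilon a\epsilon)$ projects symmetric operators onto $(TGr(\mathcal H))_\epsilon$, and defines the linear connection of $Gr(\mathcal H)$ through $\frac{D}{dt}X=\Pi_{\gamma(t)}(\dot X(t))$. The geodesics of $Gr(\mathcal H)$ starting at $\epsilon_0$ are $\delta(t)=e^{tz}\epsilon_0e^{-tz}=e^{2tz}\epsilon_0$ with $z^*=-z$, $z\epsilon_0=-\epsilon_0z$. It is known that if $\epsilon_0,\epsilon_1\in Gr(\mathcal H)$ satisfy $\|\epsilon_0-\epsilon_1\|<2$ (operator norm), there is a unique such $z$ with $\|z\|<\pi/2$ and $e^{2z}\epsilon_0=\epsilon_1$. *)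

theory Defs
  imports "HOL-Analysis.Analysis"
begin

text \<open>
  A real Hilbert space is a type \<open>'h\<close> of sort \<open>{real_inner, banach}\<close>, and \<open>'h \<Rightarrow>\<^sub>L 'h\<close> with its
  operator norm is \<open>B(H)\<close>. This type is not an instance of \<open>real_normed_algebra_1\<close>, so the library
  function \<open>exp\<close> does not apply to it.
\<close>

definition blinfun_adjoint :: "('h::{real_inner,banach} \<Rightarrow>\<^sub>L 'h) \<Rightarrow> ('h \<Rightarrow>\<^sub>L 'h)"
  where "blinfun_adjoint a = Blinfun (adjoint (blinfun_apply a))"

primrec blinfun_power :: "('h::real_normed_vector \<Rightarrow>\<^sub>L 'h) \<Rightarrow> nat \<Rightarrow> ('h \<Rightarrow>\<^sub>L 'h)"
  where
    "blinfun_power a 0 = id_blinfun"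
  | "blinfun_power a (Suc n) = a o\<^sub>L blinfun_power a n"

definition blinfun_exp :: "('h::banach \<Rightarrow>\<^sub>L 'h) \<Rightarrow> ('h \<Rightarrow>\<^sub>L 'h)"
  where "blinfun_exp a = (\<Sum>n. blinfun_power a n /\<^sub>R fact n)"

definition complex_structure :: "('h::{real_inner,banach} \<Rightarrow>\<^sub>L 'h) \<Rightarrow> bool"
  where "complex_structure J \<longleftrightarrow> blinfun_adjoint J = - J \<and> J o\<^sub>L J = - id_blinfun"

text \<open>The condition \<open>\<epsilon> = \<epsilon>\<^sup>-\<^sup>1\<close> is written as \<open>\<epsilon>\<close> being its own two-sided inverse.\<close>

definition Gr :: "('h::{real_inner,banach} \<Rightarrow>\<^sub>L 'h) set"
  where "Gr = {e. blinfun_adjoint e = e \<and> e o\<^sub>L e = id_blinfun}"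

definition Lagr :: "('h::{real_inner,banach} \<Rightarrow>\<^sub>L 'h) \<Rightarrow> ('h \<Rightarrow>\<^sub>L 'h) set"
  where "Lagr J = {e \<in> Gr. e o\<^sub>L J = - (J o\<^sub>L e)}"

definition Gr_tangent :: "('h::{real_inner,banach} \<Rightarrow>\<^sub>L 'h) \<Rightarrow> ('h \<Rightarrow>\<^sub>L 'h) set"
  where "Gr_tangent e = {x. blinfun_adjoint x = x \<and> x o\<^sub>L e = - (e o\<^sub>L x)}"

definition Lagr_tangent ::
    "('h::{real_inner,banach} \<Rightarrow>\<^sub>L 'h) \<Rightarrow> ('h \<Rightarrow>\<^sub>L 'h) \<Rightarrow> ('h \<Rightarrow>\<^sub>L 'h) set"
  where "Lagr_tangent J e = {x \<in> Gr_tangent e. x o\<^sub>L J = - (J o\<^sub>L x)}"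

definition Gr_proj ::
    "('h::{real_inner,banach} \<Rightarrow>\<^sub>L 'h) \<Rightarrow> ('h \<Rightarrow>\<^sub>L 'h) \<Rightarrow> ('h \<Rightarrow>\<^sub>L 'h)"
  where "Gr_proj e a = (1/2) *\<^sub>R (a - (e o\<^sub>L a o\<^sub>L e))"

text \<open>
  Smoothness is \<open>C\<^sup>\<infinity>\<close> for the operator norm; \<open>D n\<close> is the \<open>n\<close>-th derivative. Derivatives are
  taken within \<open>I\<close>, hence are one-sided at end points belonging to \<open>I\<close>.
\<close>

definition smooth_curve_on :: "real set \<Rightarrow> (real \<Rightarrow> 'a::real_normed_vector) \<Rightarrow> bool"
  where "smooth_curve_on I f \<longleftrightarrow>
    (\<exists>D :: nat \<Rightarrow> real \<Rightarrow> 'a. (\<forall>t\<in>I. D 0 t = f t) \<and>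
       (\<forall>n. \<forall>t\<in>I. (D n has_vector_derivative D (Suc n) t) (at t within I)))"

definition covariant_derivative ::
    "real set \<Rightarrow> (real \<Rightarrow> 'h \<Rightarrow>\<^sub>L 'h) \<Rightarrow> (real \<Rightarrow> 'h \<Rightarrow>\<^sub>L 'h) \<Rightarrow> real
      \<Rightarrow> ('h::{real_inner,banach} \<Rightarrow>\<^sub>L 'h)"
  where "covariant_derivative I \<gamma> X t = Gr_proj (\<gamma> t) (vector_derivative X (at t within I))"

definition Gr_geodesic ::
    "('h::{real_inner,banach} \<Rightarrow>\<^sub>L 'h) \<Rightarrow> ('h \<Rightarrow>\<^sub>L 'h) \<Rightarrow> real \<Rightarrow> ('h \<Rightarrow>\<^sub>L 'h)"
  where "Gr_geodesic e0 z t = blinfun_exp ((2 * t) *\<^sub>R z) o\<^sub>L e0"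

text \<open>\<open>z\<close> is the exponent of a geodesic from \<open>e0\<close> (at time 0) to \<open>e1\<close> (at time 1), with \<open>\<parallel>z\<parallel> < \<pi>/2\<close>.\<close>

definition short_geodesic_exponent ::
    "('h::{real_inner,banach} \<Rightarrow>\<^sub>L 'h) \<Rightarrow> ('h \<Rightarrow>\<^sub>L 'h) \<Rightarrow> ('h \<Rightarrow>\<^sub>L 'h) \<Rightarrow> bool"
  where "short_geodesic_exponent e0 e1 z \<longleftrightarrow>
    blinfun_adjoint z = - z \<and> z o\<^sub>L e0 = - (e0 o\<^sub>L z) \<and> norm z < pi / 2 \<and> Gr_geodesic e0 z 1 = e1"

text \<open>
  The library defines \<open>adjoint\<close> by Hilbert choice and proves its existence for Euclidean spaces only.
  The following facts, via the Riesz representation theorem, show that \<open>blinfun_adjoint\<close> is the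
  Hilbert space adjoint, and that the exponential series converges.
\<close>

lemma riesz_representation:
  fixes f :: "'h::{real_inner,banach} \<Rightarrow> real"
  assumes f: "bounded_linear f"
  shows "\<exists>y. \<forall>x. f x = x \<bullet> y"
proof -
  interpret f: bounded_linear f by fact
  define \<phi> where "\<phi> x = x \<bullet> x - 2 * f x" for x
  obtain K where K: "\<And>x. norm (f x) \<le> norm x * K" using f.bounded by blast
  have lower: "- (K^2) \<le> \<phi> x" for x
  proof -
    have "f x \<le> norm x * K" using K[of x] by simp
    moreover have "0 \<le> (norm x - K)^2" by simp
    ultimately show ?thesis
      by (simp add: \<phi>_def power2_norm_eq_inner[symmetric] power2_diff)
  qed
  define m where "m = Inf (range \<phi>)"
  have bdd: "bdd_below (range \<phi>)" using lower by (auto intro!: bdd_belowI)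
  have m_le: "m \<le> \<phi> x" for x unfolding m_def by (rule cInf_lower[OF _ bdd]) simp
  have "\<exists>x. \<phi> x < m + 1 / real (Suc n)" for n
    using cInf_lessD[of "range \<phi>" "m + 1 / real (Suc n)"] by (auto simp: m_def)
  then obtain s where s: "\<And>n. \<phi> (s n) < m + 1 / real (Suc n)" by metis
  have par: "(norm (a - b))^2 = 2 * \<phi> a + 2 * \<phi> b - 4 * \<phi> ((1/2) *\<^sub>R (a + b))" for a b
    by (simp add: \<phi>_def power2_norm_eq_inner inner_simps f.add f.scaleR inner_commute algebra_simps)
  have near: "(norm (s i - s j))^2 < 4 / real (Suc n)" if "n \<le> i" "n \<le> j" for i j n
  proof -
    have "1 / real (Suc i) \<le> 1 / real (Suc n)" "1 / real (Suc j) \<le> 1 / real (Suc n)"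
      using that by (auto simp: frac_le)
    then show ?thesis
      using par[of "s i" "s j"] s[of i] s[of j] m_le[of "(1/2) *\<^sub>R (s i + s j)"] by simp
  qed
  have "Cauchy s"
  proof (rule metric_CauchyI)
    fix e :: real assume e: "0 < e"
    obtain n :: nat where n: "4 / e^2 < real n" using reals_Archimedean2 by blast
    have "4 / real (Suc n) < e^2" using e n by (simp add: field_simps add_pos_pos add_strict_increasing)
    then have "(norm (s i - s j))^2 < e^2" if "n \<le> i" "n \<le> j" for i j
      using near[OF that] by linarith
    then have "norm (s i - s j) < e" if "n \<le> i" "n \<le> j" for i j
      using that e by (meson power_less_imp_less_base less_imp_le)
    then show "\<exists>M. \<forall>i\<ge>M. \<forall>j\<ge>M. dist (s i) (s j) < e" by (auto simp: dist_norm)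
  qed
  then obtain y where y: "s \<longlonglongrightarrow> y" using Cauchy_convergent_iff convergent_def by blast
  have "(\<lambda>n. \<phi> (s n)) \<longlonglongrightarrow> \<phi> y" unfolding \<phi>_def by (intro tendsto_intros y f.tendsto)
  moreover have "(\<lambda>n. m + 1 / real (Suc n)) \<longlonglongrightarrow> m + 0"
    by (intro tendsto_intros LIMSEQ_Suc[OF lim_1_over_n])
  ultimately have "\<phi> y \<le> m + 0"
    by (rule LIMSEQ_le) (use s in \<open>auto intro: less_imp_le\<close>)
  then have min: "\<phi> y \<le> \<phi> x" for x using m_le[of x] by linarith
  have "f x = x \<bullet> y" for x
  proof (cases "x = 0")
    case True then show ?thesis by (simp add: f.zero)
  next
    case False
    define d where "d = f x - x \<bullet> y"
    have pos: "0 < x \<bullet> x" using False by simp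
    have "\<phi> (y + (d / (x \<bullet> x)) *\<^sub>R x) = \<phi> y - d^2 / (x \<bullet> x)"
      using pos by (simp add: \<phi>_def d_def f.add f.scaleR inner_simps inner_commute
          power2_eq_square field_simps)
    then have "d^2 / (x \<bullet> x) \<le> 0" using min[of "y + (d / (x \<bullet> x)) *\<^sub>R x"] by simp
    then have "d = 0" using pos by (simp add: divide_le_0_iff)
    then show ?thesis by (simp add: d_def)
  qed
  then show ?thesis by blast
qed

lemma blinfun_adjoint_inner:
  fixes a :: "'h::{real_inner,banach} \<Rightarrow>\<^sub>L 'h"
  shows "x \<bullet> blinfun_adjoint a y = a x \<bullet> y"
proof -
  have "\<exists>w. \<forall>x. a x \<bullet> y = x \<bullet> w" for y
    by (intro riesz_representation bounded_linear_intros)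
  then have "\<exists>g. \<forall>x y. a x \<bullet> y = x \<bullet> g y" by metis
  then have adj: "\<forall>x y. a x \<bullet> y = x \<bullet> adjoint (blinfun_apply a) y"
    unfolding adjoint_def by (rule someI_ex)
  have "bounded_linear (adjoint (blinfun_apply a))"
  proof (rule bounded_linear_intro)
    fix x y and r :: real
    show "adjoint (blinfun_apply a) (x + y) = adjoint (blinfun_apply a) x + adjoint (blinfun_apply a) y"
      by (rule vector_eq_rdot[THEN iffD1], rule allI) (metis adj inner_commute inner_right_distrib)
    show "adjoint (blinfun_apply a) (r *\<^sub>R x) = r *\<^sub>R adjoint (blinfun_apply a) x"
      by (rule vector_eq_rdot[THEN iffD1], rule allI) (metis adj inner_commute inner_scaleR_right)
    show "norm (adjoint (blinfun_apply a) x) \<le> norm x * norm a"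
    proof -
      let ?w = "adjoint (blinfun_apply a) x"
      have "norm ?w * norm ?w = a ?w \<bullet> x" using adj by (simp add: norm_eq_sqrt_inner)
      also have "\<dots> \<le> norm (a ?w) * norm x" by (rule norm_cauchy_schwarz)
      also have "\<dots> \<le> norm a * norm ?w * norm x" by (intro mult_right_mono norm_blinfun) simp
      finally have "norm ?w * norm ?w \<le> norm ?w * (norm x * norm a)" by (simp add: ac_simps)
      then show ?thesis by (cases "?w = 0") simp_all
    qed
  qed
  then show ?thesis using adj by (simp add: blinfun_adjoint_def bounded_linear_Blinfun_apply)
qed

lemma blinfun_exp_sums:
  fixes a :: "'h::banach \<Rightarrow>\<^sub>L 'h"
  shows "(\<lambda>n. blinfun_power a n /\<^sub>R fact n) sums blinfun_exp a"
proof -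
  have pow: "norm (blinfun_power a n) \<le> norm a ^ n" for n
  proof (induction n)
    case 0 show ?case by (simp add: norm_blinfun_id_le)
  next
    case (Suc n)
    have "norm (blinfun_power a (Suc n)) \<le> norm a * norm (blinfun_power a n)"
      by (simp add: norm_blinfun_compose)
    also have "\<dots> \<le> norm a * norm a ^ n" by (intro mult_left_mono Suc) simp
    finally show ?case by simp
  qed
  have "summable (\<lambda>n. blinfun_power a n /\<^sub>R fact n)"
  proof (rule summable_comparison_test)
    show "\<exists>N. \<forall>n\<ge>N. norm (blinfun_power a n /\<^sub>R fact n) \<le> norm a ^ n /\<^sub>R fact n"
      using pow by (auto simp: intro!: mult_left_mono)
    show "summable (\<lambda>n. norm a ^ n /\<^sub>R fact n)" by (rule summable_exp_generic)
  qed
  then show ?thesis by (simp add: blinfun_exp_def summable_sums)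
qed

end

theory Submission
  imports Defs
begin

text \<open>
  The exponent of the geodesic is half the logarithm of the orthogonal operator \<open>g = e1 e0\<close>.
  With \<open>D = (e0 - e1)\<^sup>2 / 4\<close> and \<open>S = (g - g\<^sup>*) / 4\<close>, an eigenangle \<open>\<theta>\<close> of \<open>g\<close> gives
  \<open>D = sin\<^sup>2 (\<theta>/2)\<close> and \<open>S = \<i> sin \<theta> / 2\<close>, and \<open>\<i> arctan (t tan (\<theta>/2))\<close> is the integral over
  \<open>[0, t]\<close> of \<open>S (I - (1 - s\<^sup>2) D)\<^sup>-\<^sup>1\<close>. This defines a curve \<open>z t\<close> from \<open>0\<close> to the exponent.
  Its norm never equals \<open>\<pi>/2\<close> since \<open>I + exp (2 z t)\<close> is bounded below. For
  uniqueness, a skew operator \<open>d\<close> with \<open>\<parallel>d\<parallel> < \<pi>\<close> and \<open>exp (2 d) = I\<close> vanishes, by a Sturm comparison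
  for the equation \<open>f'' = d\<^sup>2 f\<close>. Uniqueness then makes the exponent inherit the symmetries of the
  data: it commutes with \<open>J\<close>, so the geodesic anticommutes with \<open>J\<close>.
\<close>

section \<open>Algebra and product rules for composition of bounded operators\<close>

lemma blinfun_compose_assoc: "(a o\<^sub>L b) o\<^sub>L c = a o\<^sub>L (b o\<^sub>L c)"
  by (rule blinfun_eqI) simp

lemma blinfun_compose_id [simp]: "a o\<^sub>L id_blinfun = a" "id_blinfun o\<^sub>L a = a"
  by (auto intro: blinfun_eqI)

lemmas blinfun_compose_bilinear_simps =
  bounded_bilinear.add_left[OF bounded_bilinear_blinfun_compose]
  bounded_bilinear.add_right[OF bounded_bilinear_blinfun_compose]
  bounded_bilinear.diff_left[OF bounded_bilinear_blinfun_compose]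
  bounded_bilinear.diff_right[OF bounded_bilinear_blinfun_compose]
  bounded_bilinear.minus_left[OF bounded_bilinear_blinfun_compose]
  bounded_bilinear.minus_right[OF bounded_bilinear_blinfun_compose]
  bounded_bilinear.scaleR_left[OF bounded_bilinear_blinfun_compose]
  bounded_bilinear.scaleR_right[OF bounded_bilinear_blinfun_compose]

lemmas has_vector_derivative_blinfun_compose [derivative_intros] =
  bounded_bilinear.has_vector_derivative[OF bounded_bilinear_blinfun_compose]

lemmas has_vector_derivative_blinfun_apply [derivative_intros] =
  bounded_bilinear.has_vector_derivative[OF bounded_bilinear_blinfun_apply]

lemmas has_vector_derivative_inner [derivative_intros] =
  bounded_bilinear.has_vector_derivative[OF bounded_bilinear_inner]

lemma has_vector_derivative_zero_const_on_unit:
  fixes f :: "real \<Rightarrow> 'a::real_normed_vector"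
  assumes "\<And>t. t \<in> {0..1} \<Longrightarrow> (f has_vector_derivative 0) (at t within {0..1})"
    and "s \<in> {0..1}"
  shows "f s = f 0"
proof -
  have "\<exists>c. \<forall>t\<in>{0..1}. f t = c"
    by (rule has_derivative_zero_constant)
       (use assms in \<open>auto simp: has_vector_derivative_def\<close>)
  then show ?thesis using assms(2) by auto
qed

subsection \<open>The exponential of bounded operators\<close>

lemma norm_blinfun_power: "norm (blinfun_power a n) \<le> norm a ^ n"
proof (induction n)
  case 0 show ?case by (simp add: norm_blinfun_id_le)
next
  case (Suc n)
  have "norm (blinfun_power a (Suc n)) \<le> norm a * norm (blinfun_power a n)"
    by (simp add: norm_blinfun_compose)
  also have "\<dots> \<le> norm a * norm a ^ n" by (intro mult_left_mono Suc) simp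
  finally show ?case by simp
qed

lemma blinfun_power_intertwine:
  assumes "c o\<^sub>L a = b o\<^sub>L c"
  shows "c o\<^sub>L blinfun_power a n = blinfun_power b n o\<^sub>L c"
  by (induction n) (simp_all, metis assms blinfun_compose_assoc)

text \<open>The identity holds term by term in the two series. With \<open>b = a\<close> it gives
  commutation, with \<open>b = - a\<close> it handles anticommuting \<open>c\<close>, and with
  \<open>c\<close> a symmetry or \<open>J\<close> it computes conjugates of exponentials.\<close>

lemma blinfun_exp_intertwine:
  fixes a b c :: "'h::banach \<Rightarrow>\<^sub>L 'h"
  assumes "c o\<^sub>L a = b o\<^sub>L c"
  shows "c o\<^sub>L blinfun_exp a = blinfun_exp b o\<^sub>L c"
proof -
  have "(\<lambda>n. c o\<^sub>L (blinfun_power a n /\<^sub>R fact n)) sums (c o\<^sub>L blinfun_exp a)"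
    by (intro bounded_linear.sums[OF bounded_bilinear.bounded_linear_right
          [OF bounded_bilinear_blinfun_compose]] blinfun_exp_sums)
  moreover have "(\<lambda>n. (blinfun_power b n /\<^sub>R fact n) o\<^sub>L c) sums (blinfun_exp b o\<^sub>L c)"
    by (intro bounded_linear.sums[OF bounded_bilinear.bounded_linear_left
          [OF bounded_bilinear_blinfun_compose]] blinfun_exp_sums)
  ultimately show ?thesis
    by (simp add: blinfun_compose_bilinear_simps blinfun_power_intertwine[OF assms] sums_iff)
qed

lemma blinfun_exp_zero [simp]: "blinfun_exp 0 = (id_blinfun :: 'h::banach \<Rightarrow>\<^sub>L 'h)"
proof -
  have "blinfun_power (0::'h \<Rightarrow>\<^sub>L 'h) n /\<^sub>R fact n = (if n = 0 then id_blinfun else 0)" for n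
    by (cases n) simp_all
  then show ?thesis
    using blinfun_exp_sums[of "0::'h \<Rightarrow>\<^sub>L 'h"] sums_single[of 0 "\<lambda>_. id_blinfun :: 'h \<Rightarrow>\<^sub>L 'h"]
    by (simp add: sums_iff)
qed

lemma has_vector_derivative_blinfun_power:
  assumes "(z has_vector_derivative z') (at t within S)" and "z' o\<^sub>L z t = z t o\<^sub>L z'"
  shows "((\<lambda>t. blinfun_power (z t) n) has_vector_derivative
           real n *\<^sub>R (z' o\<^sub>L blinfun_power (z t) (n - 1))) (at t within S)"
proof (induction n)
  case 0 show ?case by simp
next
  case (Suc n)
  \<comment> \<open>Commutation moves \<open>z'\<close> to the front. For \<open>n = 0\<close> the
    truncated \<open>n - 1\<close> is harmless because of the factor \<open>real n\<close>.\<close>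
  have "z t o\<^sub>L (real n *\<^sub>R (z' o\<^sub>L blinfun_power (z t) (n - 1)))
      = real n *\<^sub>R (z' o\<^sub>L blinfun_power (z t) n)"
    by (cases n) (simp_all add: blinfun_compose_bilinear_simps,
        metis assms(2) blinfun_compose_assoc)
  then show ?case
    by (auto intro!: has_vector_derivative_eq_rhs[OF has_vector_derivative_blinfun_compose
          [OF assms(1) Suc]] simp: algebra_simps)
qed

text \<open>Termwise differentiation: compactness of \<open>S\<close> bounds \<open>z\<close> and
  \<open>z'\<close>, so the differentiated series converges uniformly by the Weierstrass
  test.\<close>

lemma has_vector_derivative_blinfun_exp:
  fixes z :: "real \<Rightarrow> 'h::banach \<Rightarrow>\<^sub>L 'h"
  assumes S: "convex S" "compact S"
    and z: "\<And>t. t \<in> S \<Longrightarrow> (z has_vector_derivative z' t) (at t within S)"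
    and comm: "\<And>t. t \<in> S \<Longrightarrow> z' t o\<^sub>L z t = z t o\<^sub>L z' t"
    and cont: "continuous_on S z'" and t: "t \<in> S"
  shows "((\<lambda>t. blinfun_exp (z t)) has_vector_derivative (z' t o\<^sub>L blinfun_exp (z t)))
           (at t within S)"
proof -
  have "continuous_on S z"
    using z has_vector_derivative_continuous continuous_on_eq_continuous_within by blast
  then have "bounded (z ` S)" "bounded (z' ` S)"
    using S cont by (auto intro: compact_imp_bounded compact_continuous_image)
  then obtain K K' where K: "\<And>t. t \<in> S \<Longrightarrow> norm (z t) \<le> K" "\<And>t. t \<in> S \<Longrightarrow> norm (z' t) \<le> K'"
    unfolding bounded_iff by (metis imageI)
  \<comment> \<open>\<open>b n\<close> is the derivative of the n-th term and \<open>M n\<close>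
    bounds it. Both vanish at \<open>n = 0\<close>; shifted by one index they become exponential
    series multiplied by \<open>z' t\<close> and \<open>K'\<close>, since
    \<open>Suc n / fact (Suc n) = 1 / fact n\<close>.\<close>
  define b where "b n t = (real n / fact n) *\<^sub>R (z' t o\<^sub>L blinfun_power (z t) (n - 1))" for n t
  define M where "M n = K' * (real n / fact n * K ^ (n - 1))" for n
  have bM: "norm (b n t) \<le> M n" if "t \<in> S" for n t
  proof -
    have "norm (b n t) \<le> real n / fact n * (norm (z' t) * norm (blinfun_power (z t) (n - 1)))"
      by (simp add: b_def norm_blinfun_compose divide_right_mono mult_left_mono)
    also have "norm (blinfun_power (z t) (n - 1)) \<le> K ^ (n - 1)"
      using norm_blinfun_power K(1)[OF that] by (metis norm_ge_zero order_trans power_mono)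
    finally show ?thesis
      using K(2)[OF that] order_trans[OF norm_ge_zero K(1)[OF that]]
        order_trans[OF norm_ge_zero K(2)[OF that]] unfolding M_def
      by (smt (verit) divide_nonneg_nonneg fact_ge_zero mult.left_commute mult_left_mono mult_mono
          norm_ge_zero of_nat_0_le_iff zero_le_power)
  qed
  have fact_Suc': "real (Suc n) / fact (Suc n) = 1 / fact n" for n
    by (simp add: field_simps del: of_nat_Suc)
  have "summable (\<lambda>n. M (Suc n))"
    using summable_exp_generic[of K] unfolding M_def fact_Suc'
    by (intro summable_mult) (simp add: field_simps)
  then have "summable M" by (rule summable_Suc_iff[THEN iffD1])
  then have lim: "uniform_limit S (\<lambda>n t. \<Sum>i<n. b i t) (\<lambda>t. suminf (\<lambda>i. b i t)) sequentially"
    using bM by (intro Weierstrass_m_test)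
  have sum_b: "suminf (\<lambda>i. b i t) = z' t o\<^sub>L blinfun_exp (z t)" for t
  proof -
    have "(\<lambda>n. b (Suc n) t) sums (z' t o\<^sub>L blinfun_exp (z t))"
      using bounded_linear.sums[OF bounded_bilinear.bounded_linear_right
          [OF bounded_bilinear_blinfun_compose] blinfun_exp_sums]
      unfolding b_def fact_Suc' by (simp add: blinfun_compose_bilinear_simps divide_inverse)
    then show ?thesis by (subst (asm) sums_Suc_iff) (simp add: b_def sums_iff)
  qed
  have "\<exists>g. \<forall>t\<in>S. (\<lambda>n. blinfun_power (z t) n /\<^sub>R fact n) sums g t \<and>
      (g has_derivative (\<lambda>h. h *\<^sub>R (z' t o\<^sub>L blinfun_exp (z t)))) (at t within S)"
  proof (rule has_derivative_series[OF S(1) _ _ t blinfun_exp_sums])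
    fix n t assume "t \<in> S"
    then show "((\<lambda>t. blinfun_power (z t) n /\<^sub>R fact n) has_derivative (\<lambda>h. h *\<^sub>R b n t)) (at t within S)"
      using bounded_linear.has_vector_derivative[OF bounded_linear_scaleR_right
          has_vector_derivative_blinfun_power[OF z comm], of t "inverse (fact n)" n]
      by (simp add: b_def has_vector_derivative_def divide_inverse mult.commute)
  next
    fix e :: real assume "e > 0"
    with lim have "\<forall>\<^sub>F n in sequentially. \<forall>t\<in>S. norm ((\<Sum>i<n. b i t) - (z' t o\<^sub>L blinfun_exp (z t))) < e"
      unfolding uniform_limit_iff dist_norm sum_b by blast
    then show "\<forall>\<^sub>F n in sequentially. \<forall>t\<in>S. \<forall>h. norm ((\<Sum>i<n. h *\<^sub>R b i t)
        - h *\<^sub>R (z' t o\<^sub>L blinfun_exp (z t))) \<le> e * norm h"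
    proof (rule eventually_mono, intro ballI allI)
      fix n t h assume "\<forall>t\<in>S. norm ((\<Sum>i<n. b i t) - (z' t o\<^sub>L blinfun_exp (z t))) < e" "t \<in> S"
      then have "norm ((\<Sum>i<n. b i t) - (z' t o\<^sub>L blinfun_exp (z t))) \<le> e" by (simp add: less_imp_le)
      then show "norm ((\<Sum>i<n. h *\<^sub>R b i t) - h *\<^sub>R (z' t o\<^sub>L blinfun_exp (z t))) \<le> e * norm h"
        by (simp add: scaleR_sum_right[symmetric] scaleR_diff_right[symmetric] mult.commute[of e] mult_left_mono)
    qed
  qed
  then obtain g where g: "\<forall>t\<in>S. (\<lambda>n. blinfun_power (z t) n /\<^sub>R fact n) sums g t \<and>
      (g has_vector_derivative (z' t o\<^sub>L blinfun_exp (z t))) (at t within S)"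
    unfolding has_vector_derivative_def by blast
  then have "g t = blinfun_exp (z t)" if "t \<in> S" for t
    using that blinfun_exp_sums sums_unique2 by blast
  then show ?thesis
    using has_vector_derivative_transform[OF t] g t by metis
qed

lemma has_vector_derivative_blinfun_exp_scaleR [derivative_intros]:
  fixes a :: "'h::banach \<Rightarrow>\<^sub>L 'h"
  assumes "t \<in> {0..1}"
  shows "((\<lambda>t. blinfun_exp (t *\<^sub>R a)) has_vector_derivative (a o\<^sub>L blinfun_exp (t *\<^sub>R a)))
           (at t within {0..1})"
  by (rule has_vector_derivative_blinfun_exp[where z' = "\<lambda>_. a"])
     (use assms in \<open>auto intro!: derivative_eq_intros simp: blinfun_compose_bilinear_simps\<close>)

text \<open>The product \<open>F\<close> of the exponentials of \<open>t a\<close>,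
  \<open>t b\<close>, \<open>t c\<close> satisfies \<open>F' = (a + b + c) F = 0\<close>. The form
  with three factors yields both the inverse (\<open>b = 0\<close>) and the addition law.\<close>

lemma blinfun_exp_comp_sum_zero:
  fixes a b c :: "'h::banach \<Rightarrow>\<^sub>L 'h"
  assumes "a o\<^sub>L b = b o\<^sub>L a" "a + b + c = 0"
  shows "blinfun_exp a o\<^sub>L blinfun_exp b o\<^sub>L blinfun_exp c = id_blinfun"
proof -
  let ?E = "\<lambda>a t. blinfun_exp (t *\<^sub>R a)"
  define F where "F t = ?E a t o\<^sub>L ?E b t o\<^sub>L ?E c t" for t :: real
  have c: "c = - a - b" using assms(2) by (metis add_diff_cancel_left' diff_0 diff_add_eq_diff_diff_swap add.commute)
  have comm: "b o\<^sub>L ?E a t = ?E a t o\<^sub>L b" "c o\<^sub>L ?E a t = ?E a t o\<^sub>L c" "c o\<^sub>L ?E b t = ?E b t o\<^sub>L c"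
    for t :: real
    by (rule blinfun_exp_intertwine, simp add: c assms(1) blinfun_compose_bilinear_simps algebra_simps)+
  then have comm': "b (?E a t x) = ?E a t (b x)" "c (?E a t x) = ?E a t (c x)" "c (?E b t x) = ?E b t (c x)"
    for t :: real and x
    by (metis blinfun_apply_blinfun_compose)+
  have "F 1 = F 0"
  proof (rule has_vector_derivative_zero_const_on_unit)
    fix t :: real assume t: "t \<in> {0..1}"
    have "((a o\<^sub>L ?E a t) o\<^sub>L ?E b t o\<^sub>L ?E c t) + (?E a t o\<^sub>L (b o\<^sub>L ?E b t) o\<^sub>L ?E c t)
        + (?E a t o\<^sub>L ?E b t o\<^sub>L (c o\<^sub>L ?E c t)) = (a + b + c) o\<^sub>L F t"
      by (rule blinfun_eqI) (simp add: F_def blinfun.bilinear_simps comm'[symmetric])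
    then show "(F has_vector_derivative 0) (at t within {0..1})"
      unfolding F_def[abs_def] assms(2)
      by (auto intro!: derivative_eq_intros t simp: blinfun_compose_bilinear_simps algebra_simps)
  qed simp
  then show ?thesis by (simp add: F_def)
qed

lemma blinfun_exp_minus:
  fixes a :: "'h::banach \<Rightarrow>\<^sub>L 'h"
  shows "blinfun_exp a o\<^sub>L blinfun_exp (- a) = id_blinfun"
  using blinfun_exp_comp_sum_zero[of a 0 "- a"] by simp

lemma blinfun_exp_add:
  fixes a b :: "'h::banach \<Rightarrow>\<^sub>L 'h"
  assumes "a o\<^sub>L b = b o\<^sub>L a"
  shows "blinfun_exp (a + b) = blinfun_exp a o\<^sub>L blinfun_exp b"
proof -
  have "blinfun_exp a o\<^sub>L blinfun_exp b o\<^sub>L blinfun_exp (- (a + b)) = id_blinfun"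
    by (rule blinfun_exp_comp_sum_zero) (simp_all add: assms)
  then show ?thesis
    by (metis blinfun_compose_assoc blinfun_compose_id blinfun_exp_minus minus_minus)
qed

section \<open>Adjoints of bounded operators and of their exponentials\<close>

lemma blinfun_adjoint_eq_iff:
  "blinfun_adjoint a = b \<longleftrightarrow> (\<forall>x y. a x \<bullet> y = x \<bullet> b y)"
proof
  assume "\<forall>x y. a x \<bullet> y = x \<bullet> b y"
  then have "x \<bullet> blinfun_adjoint a y = x \<bullet> b y" for x y
    by (simp add: blinfun_adjoint_inner)
  then show "blinfun_adjoint a = b"
    by (intro blinfun_eqI) (metis vector_eq_rdot inner_commute)
qed (use blinfun_adjoint_inner in metis)

lemma blinfun_adjoint_exp: "blinfun_adjoint (blinfun_exp a) = blinfun_exp (blinfun_adjoint a)"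
  unfolding blinfun_adjoint_eq_iff
proof (intro allI)
  fix x y
  let ?b = "blinfun_adjoint a"
  have pow: "blinfun_power a n x \<bullet> y = x \<bullet> blinfun_power ?b n y" for n x y
  proof (induction n arbitrary: x y)
    case (Suc n)
    \<comment> \<open>Taking adjoints reverses the order of factors, so the new factor
      \<open>?b\<close> lands on the right and is then moved to the left.\<close>
    have "blinfun_power a (Suc n) x \<bullet> y = x \<bullet> (blinfun_power ?b n o\<^sub>L ?b) y"
      by (simp add: blinfun_adjoint_inner[of _ a y, symmetric] Suc)
    also have "blinfun_power ?b n o\<^sub>L ?b = ?b o\<^sub>L blinfun_power ?b n"
      by (simp add: blinfun_power_intertwine)
    finally show ?case by simp
  qed simp
  have "(\<lambda>n. (blinfun_power a n /\<^sub>R fact n) x \<bullet> y) sums (blinfun_exp a x \<bullet> y)"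
    by (intro bounded_linear.sums[OF _ blinfun_exp_sums] bounded_linear_intros)
  moreover have "(\<lambda>n. x \<bullet> (blinfun_power ?b n /\<^sub>R fact n) y) sums (x \<bullet> blinfun_exp ?b y)"
    by (intro bounded_linear.sums[OF _ blinfun_exp_sums] bounded_linear_intros)
  ultimately show "blinfun_exp a x \<bullet> y = x \<bullet> blinfun_exp ?b y"
    by (simp add: blinfun.scaleR_left pow sums_iff)
qed

subsection \<open>Skew-adjoint operators\<close>

lemma skew_inner:
  assumes "blinfun_adjoint z = - z"
  shows "z x \<bullet> y = - (x \<bullet> z y)"
  using assms by (simp add: blinfun_adjoint_eq_iff blinfun.minus_left)

lemma skew_scaleR:
  assumes "blinfun_adjoint z = - z"
  shows "blinfun_adjoint (r *\<^sub>R z) = - (r *\<^sub>R z)"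
  using skew_inner[OF assms] by (simp add: blinfun_adjoint_eq_iff blinfun.bilinear_simps)

lemma blinfun_exp_minus_apply [simp]:
  fixes a :: "'h::banach \<Rightarrow>\<^sub>L 'h"
  shows "blinfun_exp (- a) (blinfun_exp a x) = x" "blinfun_exp a (blinfun_exp (- a) x) = x"
  using blinfun_exp_minus[of a] blinfun_exp_minus[of "- a"]
  by (metis blinfun_apply_blinfun_compose blinfun_apply_id_blinfun id_apply minus_minus)+

text \<open>The adjoint \<open>exp (- z)\<close> is also the inverse, so \<open>exp z\<close> is
  orthogonal.\<close>

lemma norm_skew_exp:
  assumes "blinfun_adjoint z = - z"
  shows "norm (blinfun_exp z x) = norm x"
proof -
  have "blinfun_exp z x \<bullet> blinfun_exp z x = x \<bullet> x"
    using blinfun_adjoint_exp[of z] blinfun_adjoint_inner[of "blinfun_exp z x" "blinfun_exp (- z)" x]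
      blinfun_adjoint_exp[of "- z"] skew_scaleR[OF assms, of "-1"]
    by (metis assms blinfun_adjoint_inner blinfun_exp_minus_apply(1))
  then show ?thesis by (simp add: norm_eq_sqrt_inner)
qed

lemma blinfun_exp_scaleR_commute:
  fixes a :: "'h::banach \<Rightarrow>\<^sub>L 'h"
  shows "blinfun_exp (t *\<^sub>R a) (a x) = a (blinfun_exp (t *\<^sub>R a) x)"
    and "blinfun_exp (- (t *\<^sub>R a)) (a x) = a (blinfun_exp (- (t *\<^sub>R a)) x)"
proof -
  have "a o\<^sub>L blinfun_exp (t *\<^sub>R a) = blinfun_exp (t *\<^sub>R a) o\<^sub>L a"
    "a o\<^sub>L blinfun_exp (- (t *\<^sub>R a)) = blinfun_exp (- (t *\<^sub>R a)) o\<^sub>L a"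
    by (rule blinfun_exp_intertwine, simp add: blinfun_compose_bilinear_simps)+
  then show "blinfun_exp (t *\<^sub>R a) (a x) = a (blinfun_exp (t *\<^sub>R a) x)"
    and "blinfun_exp (- (t *\<^sub>R a)) (a x) = a (blinfun_exp (- (t *\<^sub>R a)) x)"
    by (metis blinfun_apply_blinfun_compose)+
qed

lemma has_vector_derivative_blinfun_exp_minus_scaleR [derivative_intros]:
  fixes a :: "'h::banach \<Rightarrow>\<^sub>L 'h"
  assumes "t \<in> {0..1}"
  shows "((\<lambda>t. blinfun_exp (- (t *\<^sub>R a))) has_vector_derivative
           - (a o\<^sub>L blinfun_exp (- (t *\<^sub>R a)))) (at t within {0..1})"
  using has_vector_derivative_blinfun_exp_scaleR[OF assms, of "- a"]
  by (simp add: blinfun_compose_bilinear_simps)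

text \<open>
  The curve \<open>f t = 2 sinh (t z) x\<close> solves \<open>f'' = z\<^sup>2 f\<close> and vanishes at both ends of the unit interval.
  Since \<open>\<parallel>z\<parallel> < \<pi>\<close>, the Jacobi-type function \<open>\<Phi>\<close> below is nondecreasing with equal end values, which
  forces \<open>f\<close> and \<open>f'\<close> to vanish together somewhere.
\<close>

lemma skew_exp_eq_id:
  fixes z :: "'h::{real_inner,banach} \<Rightarrow>\<^sub>L 'h"
  assumes skew: "blinfun_adjoint z = - z" and small: "norm z < pi"
    and exp: "blinfun_exp (2 *\<^sub>R z) = id_blinfun"
  shows "z = 0"
proof (rule blinfun_eqI)
  fix x
  \<comment> \<open>A number strictly between \<open>norm z\<close> and \<open>pi\<close>:
    \<open>norm z < l\<close> makes the comparison strict, and \<open>l < pi\<close> keeps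
    \<open>l * (t - 1/2)\<close> where \<open>cos\<close> is positive.\<close>
  define l where "l = (norm z + pi) / 2"
  have l: "norm z < l" "0 < l" "l < pi" using small by (auto simp: l_def intro: add_nonneg_pos)
  define f where "f t = blinfun_exp (t *\<^sub>R z) x - blinfun_exp (- (t *\<^sub>R z)) x" for t :: real
  define f1 where "f1 t = z (blinfun_exp (t *\<^sub>R z) x + blinfun_exp (- (t *\<^sub>R z)) x)" for t :: real
  \<comment> \<open>With the positive solution \<open>u t = cos (l * (t - 1/2))\<close> of
    \<open>u'' = - l^2 u\<close>, this is \<open>f \<bullet> (f' - (u'/u) f)\<close>; Picone's
    identity gives its derivative \<open>d\<close> as a sum of two nonnegative terms.\<close>
  define \<Phi> where "\<Phi> t = f t \<bullet> f1 t + l * tan (l * (t - 1/2)) * (f t \<bullet> f t)" for t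
  define d where "d t = (norm (f1 t + (l * tan (l * (t - 1/2))) *\<^sub>R f t))\<^sup>2
      + (l\<^sup>2 * (norm (f t))\<^sup>2 - (norm (z (f t)))\<^sup>2)" for t
  have f': "(f has_vector_derivative f1 t) (at t within {0..1})"
    and f1': "(f1 has_vector_derivative z (z (f t))) (at t within {0..1})" if "t \<in> {0..1}" for t
    unfolding f_def[abs_def] f1_def[abs_def]
    by (auto intro!: derivative_eq_intros that simp: blinfun.bilinear_simps)
  have \<Phi>': "(\<Phi> has_real_derivative d t) (at t within {0..1})" if t: "t \<in> {0..1}" for t
  proof -
    let ?a = "l * (t - 1/2)"
    have ff1: "((\<lambda>t. f t \<bullet> f1 t) has_real_derivative (f t \<bullet> z (z (f t)) + f1 t \<bullet> f1 t)) (at t within {0..1})"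
      and ff: "((\<lambda>t. f t \<bullet> f t) has_real_derivative (f t \<bullet> f1 t + f1 t \<bullet> f t)) (at t within {0..1})"
      unfolding has_real_derivative_iff_has_vector_derivative
      by (intro has_vector_derivative_inner f' f1' t)+
    have "\<bar>t - 1/2\<bar> \<le> 1/2" using t unfolding atLeastAtMost_iff by linarith
    then have "\<bar>?a\<bar> \<le> l * (1/2)" using l by (simp add: abs_mult)
    then have "- (pi / 2) < ?a \<and> ?a < pi / 2" using l by linarith
    then have cos: "cos ?a \<noteq> 0" using cos_gt_zero_pi[of ?a] by auto
    have tan: "((\<lambda>t. tan (l * (t - 1/2))) has_real_derivative (1 + (tan ?a)\<^sup>2) * l) (at t within {0..1})"
      unfolding tan_sec[OF cos] power_inverse
      by (rule DERIV_chain2[where f = tan and g = "\<lambda>t. l * (t - 1/2)" and x = t, OF DERIV_tan[OF cos]]) (auto intro!: derivative_eq_intros)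
    have d: "d t = f1 t \<bullet> f1 t + 2 * (l * tan ?a) * (f t \<bullet> f1 t) + (l * tan ?a)\<^sup>2 * (f t \<bullet> f t)
        + l\<^sup>2 * (f t \<bullet> f t) + f t \<bullet> z (z (f t))"
      unfolding d_def power2_norm_eq_inner using skew_inner[OF skew, of "f t" "z (f t)"]
      by (simp add: inner_simps inner_commute algebra_simps power2_eq_square)
    show ?thesis
      unfolding \<Phi>_def[abs_def] d
      by (rule DERIV_cong[OF DERIV_add[OF ff1 DERIV_mult[OF DERIV_cmult[OF tan] ff]]])
         (simp add: inner_commute algebra_simps power2_eq_square)
  qed
  have "\<exists>t\<in>{0<..<1}. \<Phi> 1 - \<Phi> 0 = d t * (1 - 0)"
    by (rule mvt_simple) (use \<Phi>' in \<open>auto simp: has_field_derivative_def\<close>)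
  \<comment> \<open>This makes \<open>f 1 = 0\<close>, so \<open>\<Phi>\<close> has equal end values
    and the mean value theorem supplies a zero of \<open>d\<close>.\<close>
  moreover have "blinfun_exp z = blinfun_exp (- z)"
    using exp blinfun_exp_add[of z z]
    by (metis blinfun_compose_assoc blinfun_compose_id blinfun_exp_minus scaleR_2)
  then have "f 0 = 0" "f 1 = 0" by (simp_all add: f_def)
  then have "\<Phi> 0 = 0" "\<Phi> 1 = 0" by (simp_all add: \<Phi>_def)
  ultimately obtain t where t: "d t = 0" by auto
  have zf: "(norm (z (f t)))\<^sup>2 \<le> (norm z)\<^sup>2 * (norm (f t))\<^sup>2"
    unfolding power_mult_distrib[symmetric] by (intro power_mono norm_blinfun) simp
  \<comment> \<open>Both terms of \<open>d t\<close> are nonnegative, hence zero; as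
    \<open>norm z < l\<close>, the second vanishes only if \<open>f t = 0\<close>.\<close>
  have "f t = 0"
  proof (rule ccontr)
    assume "f t \<noteq> 0"
    then have "(norm z)\<^sup>2 * (norm (f t))\<^sup>2 < l\<^sup>2 * (norm (f t))\<^sup>2"
      using l by (intro mult_strict_right_mono power_strict_mono) auto
    with zf t show False unfolding d_def by (smt (verit) zero_le_power2)
  qed
  moreover from this have "f1 t = 0" using t by (simp add: d_def)
  \<comment> \<open>\<open>f t = 0\<close> says that the two exponentials agree on \<open>x\<close>,
    so \<open>f1 t\<close> is twice this vector. Cancelling the exponential, which is invertible and
    commutes with \<open>z\<close>, leaves \<open>z x = 0\<close>.\<close>
  ultimately have "z (blinfun_exp (t *\<^sub>R z) x) = 0"
    by (simp add: f_def f1_def blinfun.add_right blinfun.scaleR_right flip: scaleR_2)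
  then show "z x = blinfun_apply 0 x"
    using blinfun_exp_minus_apply(1)[of "t *\<^sub>R z" "z x"]
    by (simp add: blinfun_exp_scaleR_commute)
qed

text \<open>For commuting exponents the hypothesis becomes \<open>exp (2 (z - w)) = I\<close>, with
  \<open>norm (z - w) < pi\<close>.\<close>

lemma skew_exp_unique:
  fixes z w :: "'h::{real_inner,banach} \<Rightarrow>\<^sub>L 'h"
  assumes "blinfun_adjoint z = - z" "norm z < pi / 2" "blinfun_adjoint w = - w" "norm w < pi / 2"
    and comm: "z o\<^sub>L w = w o\<^sub>L z" and "blinfun_exp (2 *\<^sub>R z) = blinfun_exp (2 *\<^sub>R w)"
  shows "z = w"
proof -
  have "z - w = 0"
  proof (rule skew_exp_eq_id)
    show "blinfun_adjoint (z - w) = - (z - w)"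
      using skew_inner[OF assms(1)] skew_inner[OF assms(3)]
      by (simp add: blinfun_adjoint_eq_iff blinfun.bilinear_simps inner_simps)
    show "norm (z - w) < pi" using assms(2,4) norm_triangle_ineq4[of z w] by simp
    have "blinfun_exp (2 *\<^sub>R (z - w)) = blinfun_exp (2 *\<^sub>R z + - (2 *\<^sub>R w))"
      by (simp add: scaleR_diff_right)
    also have "\<dots> = blinfun_exp (2 *\<^sub>R w) o\<^sub>L blinfun_exp (- (2 *\<^sub>R w))"
      by (subst blinfun_exp_add) (simp_all add: assms(6) comm blinfun_compose_bilinear_simps)
    finally show "blinfun_exp (2 *\<^sub>R (z - w)) = id_blinfun" by (simp add: blinfun_exp_minus)
  qed
  then show ?thesis by simp
qed

text \<open>
  Norms of skew operators are nearly attained at approximate eigenvectors of \<open>z\<^sup>2\<close>, so at norm \<open>\<pi>/2\<close>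
  the operator \<open>cosh z\<close>, hence \<open>I + exp (2 z)\<close>, would not be bounded below.
\<close>

lemma skew_norm_less_pi_half:
  fixes z :: "'h::{real_inner,banach} \<Rightarrow>\<^sub>L 'h"
  assumes skew: "blinfun_adjoint z = - z" and le: "norm z \<le> pi / 2" and k: "0 < k"
    and below: "\<And>x. k * norm x \<le> norm (x + blinfun_exp (2 *\<^sub>R z) x)"
  shows "norm z < pi / 2"
proof -
  define b :: real where "b = pi / 2"
  have b: "0 < b" by (simp add: b_def)
  have main: "b * (k * norm x) \<le> 2 * norm (z (z x) + b\<^sup>2 *\<^sub>R x)" for x
  proof -
    let ?r = "z (z x) + b\<^sup>2 *\<^sub>R x"
    define v where "v t = blinfun_exp (t *\<^sub>R z) x + blinfun_exp (- (t *\<^sub>R z)) x" for t :: real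
    define v1 where "v1 t = z (blinfun_exp (t *\<^sub>R z) x - blinfun_exp (- (t *\<^sub>R z)) x)" for t :: real
    \<comment> \<open>With \<open>u t = sin (b * (1 - t))\<close>, so that
      \<open>u'' = - b^2 u\<close>, this is the Wronskian \<open>u v' - u' v\<close> against
      \<open>v t = 2 cosh (t z) x\<close>. Its derivative \<open>u (v'' + b^2 v)\<close> sees only
      the defect \<open>?r\<close>, and \<open>b = pi / 2\<close> makes
      \<open>G 0 = 0\<close>.\<close>
    define G where "G t = sin (b * (1 - t)) *\<^sub>R v1 t + (b * cos (b * (1 - t))) *\<^sub>R v t" for t
    define G' where "G' t = sin (b * (1 - t)) *\<^sub>R (blinfun_exp (t *\<^sub>R z) ?r + blinfun_exp (- (t *\<^sub>R z)) ?r)" for t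
    have G': "(G has_vector_derivative G' t) (at t within {0..1})" if "t \<in> {0..1}" for t
      unfolding G_def[abs_def] G'_def v_def[abs_def] v1_def[abs_def]
      by (rule derivative_eq_intros that refl)+
         (simp add: blinfun.bilinear_simps blinfun_exp_scaleR_commute algebra_simps power2_eq_square)
    have "norm (G' t) \<le> 2 * norm ?r" for t
    proof -
      have "norm (G' t) \<le> 1 * (norm ?r + norm ?r)"
        unfolding G'_def norm_scaleR
        by (intro mult_mono order_trans[OF norm_triangle_ineq])
           (simp_all add: norm_skew_exp skew_scaleR[OF skew]
              skew_scaleR[OF skew, of "- t" for t, simplified])
      then show ?thesis by simp
    qed
    then have "norm (G 1 - G 0) \<le> 2 * norm ?r * norm (1 - 0 :: real)"
      by (intro differentiable_bound[of "{0..1}" _ "\<lambda>t h. h *\<^sub>R G' t"])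
         (use G' in \<open>auto simp: has_vector_derivative_def mult.commute[of _ "\<bar>_\<bar>"]
             intro!: onorm_le mult_left_mono\<close>)
    moreover have "G 0 = 0" "G 1 = b *\<^sub>R v 1" by (simp_all add: G_def v1_def b_def)
    ultimately have "b * norm (v 1) \<le> 2 * norm ?r" using b by simp
    moreover have "norm (v 1) = norm (x + blinfun_exp (2 *\<^sub>R z) x)"
    proof -
      \<comment> \<open>\<open>x + exp (2 z) x\<close> is \<open>exp z\<close> applied to
        \<open>v 1\<close>, and these exponentials are isometric.\<close>
      have "blinfun_exp (- z) (x + blinfun_exp (2 *\<^sub>R z) x) = v 1"
        using blinfun_exp_add[of z z] by (simp add: v_def blinfun.add_right scaleR_2)
      then show ?thesis
        using norm_skew_exp[OF skew_scaleR[OF skew, of "-1"]] by (metis scaleR_minus1_left)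
    qed
    ultimately show ?thesis using below[of x] b by (smt (verit) mult_left_mono)
  qed
  \<comment> \<open>Squaring \<open>main\<close> and using
    \<open>norm (z (z x)) \<le> b^2 * norm x\<close> yields
    \<open>norm (z x)^2 \<le> (b^2 - k^2 / 8) * norm x^2\<close>, a bound strictly below
    \<open>b\<close>. The maximum with 0 keeps the radicand nonnegative.\<close>
  define B where "B = sqrt (max 0 (b\<^sup>2 - k\<^sup>2 / 8))"
  have "norm z \<le> B"
  proof (rule norm_blinfun_bound)
    show "0 \<le> B" by (simp add: B_def)
    fix x
    have zb: "norm (z y) \<le> b * norm y" for y
      using norm_blinfun[of z y] le by (smt (verit) b_def mult_right_mono norm_ge_zero)
    have "(norm (z (z x)))\<^sup>2 \<le> (b * (b * norm x))\<^sup>2"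
      by (intro power_mono order_trans[OF zb] mult_left_mono zb) (use b in auto)
    moreover have "(b * (k * norm x))\<^sup>2 \<le> (2 * norm (z (z x) + b\<^sup>2 *\<^sub>R x))\<^sup>2"
      by (intro power_mono main) (use b k in auto)
    moreover have "(norm (z (z x) + b\<^sup>2 *\<^sub>R x))\<^sup>2
        = (norm (z (z x)))\<^sup>2 - 2 * b\<^sup>2 * (norm (z x))\<^sup>2 + b^4 * (norm x)\<^sup>2"
      unfolding power2_norm_eq_inner using skew_inner[OF skew, of "z x" x]
      by (simp add: inner_simps inner_commute algebra_simps power2_eq_square eval_nat_numeral)
    ultimately have "b\<^sup>2 * (k\<^sup>2 * (norm x)\<^sup>2) \<le> b\<^sup>2 * (8 * (b\<^sup>2 * (norm x)\<^sup>2 - (norm (z x))\<^sup>2))"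
      by (simp add: power_mult_distrib algebra_simps eval_nat_numeral)
    then have "k\<^sup>2 * (norm x)\<^sup>2 \<le> 8 * (b\<^sup>2 * (norm x)\<^sup>2 - (norm (z x))\<^sup>2)"
      using b by (simp add: mult_le_cancel_left_pos)
    then have "(norm (z x))\<^sup>2 \<le> (b\<^sup>2 - k\<^sup>2 / 8) * (norm x)\<^sup>2" by (simp add: algebra_simps)
    also have "\<dots> \<le> (B * norm x)\<^sup>2"
      by (simp add: B_def power_mult_distrib mult_right_mono)
    finally show "norm (z x) \<le> B * norm x"
      by (rule power2_le_imp_le) (simp add: B_def)
  qed
  also have "B < sqrt (b\<^sup>2)"
    unfolding B_def using b k by (intro real_sqrt_less_mono) simp
  finally show ?thesis using b by (simp add: b_def)
qed

subsection \<open>Inverses\<close>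

text \<open>The identity \<open>R u - R t = - R u (T u - T t) R t\<close> and the uniform bound
  \<open>K\<close> first give continuity of \<open>R\<close>; feeding this back into the factor
  \<open>R u\<close> gives the derivative.\<close>

lemma has_vector_derivative_blinfun_inverse:
  fixes T R :: "real \<Rightarrow> 'h::banach \<Rightarrow>\<^sub>L 'h"
  assumes T: "(T has_vector_derivative T') (at t within S)" and t: "t \<in> S"
    and inv: "\<And>u. u \<in> S \<Longrightarrow> R u o\<^sub>L T u = id_blinfun" "\<And>u. u \<in> S \<Longrightarrow> T u o\<^sub>L R u = id_blinfun"
    and K: "\<And>u. u \<in> S \<Longrightarrow> norm (R u) \<le> K"
  shows "(R has_vector_derivative - (R t o\<^sub>L T' o\<^sub>L R t)) (at t within S)"
proof -
  let ?F = "at t within S"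
  have inv': "R u (T u x) = x" "T u (R u x) = x" if "u \<in> S" for u x
    using inv[OF that] by (metis blinfun_apply_blinfun_compose blinfun_apply_id_blinfun id_apply)+
  have K0: "0 \<le> K" using K[OF t] norm_ge_zero order_trans by blast
  have diff: "R u - R t = - (R u o\<^sub>L (T u - T t) o\<^sub>L R t)" if "u \<in> S" for u
    by (rule blinfun_eqI) (simp add: blinfun.bilinear_simps inv' that t)
  have T0: "((\<lambda>u. norm (T u - T t)) \<longlongrightarrow> 0) ?F"
    using has_vector_derivative_continuous[OF T]
    by (simp add: continuous_within LIM_zero tendsto_norm_zero)
  have "((\<lambda>u. R u - R t) \<longlongrightarrow> 0) ?F"
  proof (rule Lim_null_comparison)
    show "\<forall>\<^sub>F u in ?F. norm (R u - R t) \<le> K * norm (T u - T t) * K"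
      unfolding eventually_at_topological
    proof (intro exI[of _ UNIV] conjI ballI impI)
      fix u assume "u \<in> S"
      then show "norm (R u - R t) \<le> K * norm (T u - T t) * K"
        unfolding diff[OF \<open>u \<in> S\<close>] norm_minus_cancel
        by (intro order_trans[OF norm_blinfun_compose] mult_mono K t) (use K0 in auto)
    qed auto
    show "((\<lambda>u. K * norm (T u - T t) * K) \<longlongrightarrow> 0) ?F"
      by (rule tendsto_eq_intros T0 | simp)+
  qed
  then have R0: "((\<lambda>u. norm (R u - R t)) \<longlongrightarrow> 0) ?F" by (rule tendsto_norm_zero)
  define \<rho> where "\<rho> u = norm (T u - T t - (u - t) *\<^sub>R T') / norm (u - t)" for u
  have \<rho>0: "(\<rho> \<longlongrightarrow> 0) ?F"
    using T unfolding has_vector_derivative_def has_derivative_iff_norm \<rho>_def by auto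
  show ?thesis
    unfolding has_vector_derivative_def has_derivative_iff_norm
  proof (intro conjI bounded_linear_scaleR_left, rule Lim_null_comparison)
    show "((\<lambda>u. K * \<rho> u * K + norm (R u - R t) * norm T' * K) \<longlongrightarrow> 0) ?F"
      by (rule tendsto_eq_intros \<rho>0 R0 | simp)+
    show "\<forall>\<^sub>F u in ?F. norm (norm (R u - R t - (u - t) *\<^sub>R - (R t o\<^sub>L T' o\<^sub>L R t)) / norm (u - t))
        \<le> K * \<rho> u * K + norm (R u - R t) * norm T' * K"
      unfolding eventually_at_topological
    proof (intro exI[of _ UNIV] conjI ballI impI)
      fix u assume u: "u \<noteq> t" "u \<in> S"
      let ?d = "T u - T t - (u - t) *\<^sub>R T'"
      have "R u - R t - (u - t) *\<^sub>R - (R t o\<^sub>L T' o\<^sub>L R t)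
          = - (R u o\<^sub>L ?d o\<^sub>L R t) - (u - t) *\<^sub>R ((R u - R t) o\<^sub>L T' o\<^sub>L R t)"
        by (rule blinfun_eqI) (simp add: blinfun.bilinear_simps inv' u t algebra_simps)
      also have "norm \<dots> \<le> norm (R u o\<^sub>L ?d o\<^sub>L R t) + \<bar>u - t\<bar> * norm ((R u - R t) o\<^sub>L T' o\<^sub>L R t)"
        by (rule order_trans[OF norm_triangle_ineq4]) simp
      also have "\<dots> \<le> K * norm ?d * K + \<bar>u - t\<bar> * (norm (R u - R t) * norm T' * K)"
        by (intro add_mono mult_left_mono order_trans[OF norm_blinfun_compose] mult_mono
            order_trans[OF norm_blinfun_compose] K t u) (use K0 in auto)
      finally show "norm (norm (R u - R t - (u - t) *\<^sub>R - (R t o\<^sub>L T' o\<^sub>L R t)) / norm (u - t))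
          \<le> K * \<rho> u * K + norm (R u - R t) * norm T' * K"
        using u by (simp add: \<rho>_def field_simps)
    qed auto
  qed
qed

lemma blinfun_neumann_inverse:
  fixes D :: "'h::banach \<Rightarrow>\<^sub>L 'h"
  assumes "norm D < 1"
  obtains R where "R o\<^sub>L (id_blinfun - D) = id_blinfun" "(id_blinfun - D) o\<^sub>L R = id_blinfun"
    "norm R \<le> 1 / (1 - norm D)"
proof
  define R where "R = (\<Sum>n. blinfun_power D n)"
  have geo: "summable (\<lambda>n. norm D ^ n)" using assms by (simp add: summable_geometric)
  have sn: "summable (\<lambda>n. norm (blinfun_power D n))"
    by (rule summable_comparison_test[OF _ geo]) (auto simp: norm_blinfun_power)
  have s: "summable (blinfun_power D)" by (rule summable_norm_cancel[OF sn])
  have DR: "D o\<^sub>L R = R - id_blinfun"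
    using suminf_split_head[OF s] bounded_linear.suminf[OF bounded_bilinear.bounded_linear_right
        [OF bounded_bilinear_blinfun_compose] s, of D]
    by (simp add: R_def)
  have "D o\<^sub>L R = R o\<^sub>L D"
    using bounded_linear.suminf[OF bounded_bilinear.bounded_linear_right
        [OF bounded_bilinear_blinfun_compose] s, of D]
      bounded_linear.suminf[OF bounded_bilinear.bounded_linear_left
        [OF bounded_bilinear_blinfun_compose] s, of D]
    by (simp add: R_def blinfun_power_intertwine[OF refl])
  with DR show "R o\<^sub>L (id_blinfun - D) = id_blinfun" "(id_blinfun - D) o\<^sub>L R = id_blinfun"
    by (simp_all add: blinfun_compose_bilinear_simps)
  have "norm R \<le> (\<Sum>n. norm (blinfun_power D n))" unfolding R_def by (rule summable_norm[OF sn])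
  also have "\<dots> \<le> (\<Sum>n. norm D ^ n)" by (rule suminf_le[OF norm_blinfun_power sn geo])
  also have "\<dots> = 1 / (1 - norm D)" by (rule suminf_geometric) (use assms in simp)
  finally show "norm R \<le> 1 / (1 - norm D)" .
qed

subsection \<open>Skew logarithms of orthogonal operators\<close>

text \<open>In terms of angles, \<open>D = sin^2 (\<theta>/2)\<close> and
  \<open>S = i sin (\<theta>/2) cos (\<theta>/2)\<close>, so \<open>S^2 = D^2 - D\<close>, and
  \<open>I - 2 D + 2 S\<close> is \<open>exp (i \<theta>)\<close>. The commutation clause later
  allows a rival logarithm to be compared with \<open>z\<close>.\<close>

lemma skew_logarithm_exists:
  fixes S D :: "'h::{real_inner,banach} \<Rightarrow>\<^sub>L 'h"
  assumes S: "blinfun_adjoint S = - S" and D: "blinfun_adjoint D = D"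
    and SD: "S o\<^sub>L D = D o\<^sub>L S" and SS: "S o\<^sub>L S = (D o\<^sub>L D) - D" and D1: "norm D < 1"
  obtains z where "blinfun_adjoint z = - z" "norm z < pi / 2"
    "blinfun_exp (2 *\<^sub>R z) = id_blinfun - 2 *\<^sub>R D + 2 *\<^sub>R S"
    "\<And>b. b o\<^sub>L S = S o\<^sub>L b \<Longrightarrow> b o\<^sub>L D = D o\<^sub>L b \<Longrightarrow> b o\<^sub>L z = z o\<^sub>L b"
proof -
  let ?I = "{0..1::real}"
  \<comment> \<open>\<open>T t\<close> is
    \<open>cos^2 (\<theta>/2) + t^2 sin^2 (\<theta>/2)\<close>, the denominator in the derivative of
    \<open>arctan (t tan (\<theta>/2))\<close>; \<open>norm D < 1\<close> makes it invertible with a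
    bound uniform in \<open>t\<close>.\<close>
  define T where "T t = id_blinfun - (1 - t\<^sup>2) *\<^sub>R D" for t :: real
  have "\<exists>R. R o\<^sub>L T t = id_blinfun \<and> T t o\<^sub>L R = id_blinfun \<and> norm R \<le> 1 / (1 - norm D)"
    if "t \<in> ?I" for t
  proof -
    have t2: "0 \<le> 1 - t\<^sup>2" "1 - t\<^sup>2 \<le> 1" using that by (simp_all add: power_le_one)
    then have le: "norm ((1 - t\<^sup>2) *\<^sub>R D) \<le> norm D"
      using mult_right_mono[OF t2(2), of "norm D"] by simp
    then obtain R where "R o\<^sub>L T t = id_blinfun" "T t o\<^sub>L R = id_blinfun"
      "norm R \<le> 1 / (1 - norm ((1 - t\<^sup>2) *\<^sub>R D))"
      using blinfun_neumann_inverse[of "(1 - t\<^sup>2) *\<^sub>R D"] D1 unfolding T_def by auto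
    moreover from this(3) have "norm R \<le> 1 / (1 - norm D)"
      using le D1 by (elim order_trans) (simp add: frac_le)
    ultimately show ?thesis by blast
  qed
  then obtain R where R: "\<And>t. t \<in> ?I \<Longrightarrow> R t o\<^sub>L T t = id_blinfun"
    "\<And>t. t \<in> ?I \<Longrightarrow> T t o\<^sub>L R t = id_blinfun" "\<And>t. t \<in> ?I \<Longrightarrow> norm (R t) \<le> 1 / (1 - norm D)"
    by metis
  have RT: "R t (T t x) = x" "T t (R t x) = x" if "t \<in> ?I" for t x
    using R(1,2)[OF that] by (metis blinfun_apply_blinfun_compose blinfun_apply_id_blinfun id_apply)+
  have T': "(T has_vector_derivative (2 * t) *\<^sub>R D) (at t within ?I)" for t
    unfolding T_def[abs_def] by (auto intro!: derivative_eq_intros)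
  have R': "(R has_vector_derivative - (R t o\<^sub>L (2 * t) *\<^sub>R D o\<^sub>L R t)) (at t within ?I)" if "t \<in> ?I" for t
    by (rule has_vector_derivative_blinfun_inverse[OF T' that R])
  define z' where "z' t = S o\<^sub>L R t" for t
  have cont: "continuous_on ?I z'"
    unfolding z'_def[abs_def] using R'
    by (intro bounded_bilinear.continuous_on[OF bounded_bilinear_blinfun_compose] continuous_on_const
        continuous_on_vector_derivative)
  define z where "z t = integral {0..t} z'" for t
  have z_deriv: "(z has_vector_derivative z' t) (at t within ?I)" if "t \<in> ?I" for t
    unfolding z_def[abs_def] by (rule integral_has_vector_derivative[OF cont that])
  \<comment> \<open>Linear conditions on the integrand pass to the integral; this serves for
    commutators and for skewness.\<close>
  have z_linear: "L (z t) = 0"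
    if L: "bounded_linear L" "\<And>s. s \<in> ?I \<Longrightarrow> L (z' s) = 0" and t: "t \<in> ?I"
    for L :: "('h \<Rightarrow>\<^sub>L 'h) \<Rightarrow> 'b::banach" and t
  proof -
    have "continuous_on {0..t} z'" by (rule continuous_on_subset[OF cont]) (use t in auto)
    then have "L (z t) = integral {0..t} (L \<circ> z')"
      unfolding z_def using L(1) by (simp add: integral_linear integrable_continuous_real)
    also have "\<dots> = integral {0..t} (\<lambda>_. 0)" by (rule integral_cong) (use L(2) t in auto)
    finally show ?thesis by simp
  qed
  have R_comm: "b o\<^sub>L R t = R t o\<^sub>L b" if "b o\<^sub>L D = D o\<^sub>L b" "t \<in> ?I" for b t
  proof (rule blinfun_eqI)
    fix x
    have "b (T t y) = T t (b y)" for y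
      using that(1) unfolding T_def
      by (simp add: blinfun.bilinear_simps) (metis blinfun_apply_blinfun_compose)
    then show "(b o\<^sub>L R t) x = (R t o\<^sub>L b) x"
      using RT[OF that(2)] by (metis blinfun_apply_blinfun_compose)
  qed
  have z'_comm: "b o\<^sub>L z' t = z' t o\<^sub>L b" if "b o\<^sub>L S = S o\<^sub>L b" "b o\<^sub>L D = D o\<^sub>L b" "t \<in> ?I" for b t
    using R_comm[OF that(2,3)] that(1) unfolding z'_def by (metis blinfun_compose_assoc)
  have z_comm: "b o\<^sub>L z t = z t o\<^sub>L b" if "\<And>s. s \<in> ?I \<Longrightarrow> b o\<^sub>L z' s = z' s o\<^sub>L b" "t \<in> ?I" for b t
  proof -
    have "bounded_linear (\<lambda>a. (b o\<^sub>L a) - (a o\<^sub>L b))"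
      by (intro bounded_linear_sub bounded_bilinear.bounded_linear_right
          bounded_bilinear.bounded_linear_left bounded_bilinear_blinfun_compose)
    from z_linear[OF this _ that(2)] that(1) show ?thesis by simp
  qed
  have S_z': "S o\<^sub>L z' t = z' t o\<^sub>L S" and D_z': "D o\<^sub>L z' t = z' t o\<^sub>L D" if "t \<in> ?I" for t
    using z'_comm[OF _ _ that] SD by simp_all
  \<comment> \<open>\<open>z' s\<close> commutes with \<open>S\<close> and \<open>D\<close>, hence
    with every value of \<open>z'\<close>, hence with the integral \<open>z t\<close>.\<close>
  have z'_z: "z' s o\<^sub>L z t = z t o\<^sub>L z' s" if "s \<in> ?I" "t \<in> ?I" for s t
    using z_comm[OF z'_comm[OF S_z'[symmetric] D_z'[symmetric]]] that by blast
  have R_self: "R t x \<bullet> y = x \<bullet> R t y" if "t \<in> ?I" for t x y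
  proof -
    have "T t (R t x) \<bullet> R t y = R t x \<bullet> T t (R t y)"
      using D by (simp add: T_def blinfun_adjoint_eq_iff blinfun.bilinear_simps inner_simps)
    then show ?thesis unfolding RT(2)[OF that] by simp
  qed
  have z'_skew: "z' t x \<bullet> y = - (x \<bullet> z' t y)" if t: "t \<in> ?I" for t x y
  proof -
    have "z' t x \<bullet> y = - (x \<bullet> (R t o\<^sub>L S) y)"
      by (simp add: z'_def skew_inner[OF S] R_self[OF t])
    also have "R t o\<^sub>L S = z' t" unfolding z'_def by (rule R_comm[OF SD t, symmetric])
    finally show ?thesis .
  qed
  have z_skew: "blinfun_adjoint (z t) = - z t" if t: "t \<in> ?I" for t
  proof -
    have "bounded_linear (\<lambda>a :: 'h \<Rightarrow>\<^sub>L 'h. a x \<bullet> y + x \<bullet> a y)" for x y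
      by (intro bounded_linear_add bounded_linear_intros)
    from z_linear[OF this _ t] have "z t x \<bullet> y + x \<bullet> z t y = 0" for x y by (simp add: z'_skew)
    then show ?thesis
      unfolding blinfun_adjoint_eq_iff by (simp add: blinfun.minus_left eq_neg_iff_add_eq_0)
  qed

  \<comment> \<open>\<open>M t\<close> is \<open>(cos (\<theta>/2) + i t sin (\<theta>/2))^2\<close>
    and \<open>T t\<close> is its modulus, so \<open>M t o R t\<close> is the expected value of
    \<open>exp (2 z t)\<close>; at \<open>t = 1\<close> it is the target operator.\<close>
  define M where "M t = id_blinfun - (1 + t\<^sup>2) *\<^sub>R D + (2 * t) *\<^sub>R S" for t :: real
  have M': "(M has_vector_derivative (2 *\<^sub>R S - (2 * t) *\<^sub>R D)) (at t within ?I)" for t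
    unfolding M_def[abs_def] by (auto intro!: derivative_eq_intros)
  have SDx: "S (D x) = D (S x)" "S (S x) = D (D x) - D x" for x
    using SD SS by (metis blinfun_apply_blinfun_compose blinfun.diff_left)+
  define E where "E t = blinfun_exp (- (2 *\<^sub>R z t))" for t
  have E': "(E has_vector_derivative (- (2 *\<^sub>R z' t) o\<^sub>L E t)) (at t within ?I)" if t: "t \<in> ?I" for t
    unfolding E_def[abs_def]
  proof (rule has_vector_derivative_blinfun_exp[OF _ _ _ _ _ t])
    fix s assume s: "s \<in> ?I"
    show "((\<lambda>t. - (2 *\<^sub>R z t)) has_vector_derivative - (2 *\<^sub>R z' s)) (at s within ?I)"
      by (auto intro!: derivative_eq_intros z_deriv s)
    show "- (2 *\<^sub>R z' s) o\<^sub>L - (2 *\<^sub>R z s) = - (2 *\<^sub>R z s) o\<^sub>L - (2 *\<^sub>R z' s)"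
      by (simp add: blinfun_compose_bilinear_simps z'_z[OF s s])
  qed (auto intro!: continuous_intros cont)
  have W: "E t o\<^sub>L M t o\<^sub>L R t = id_blinfun" if t: "t \<in> ?I" for t
  proof -
    have "E t o\<^sub>L M t o\<^sub>L R t = E 0 o\<^sub>L M 0 o\<^sub>L R 0"
    proof (rule has_vector_derivative_zero_const_on_unit[OF _ t])
      fix t assume t: "t \<in> ?I"
      have E_comm: "z' t o\<^sub>L E t = E t o\<^sub>L z' t"
        unfolding E_def by (rule blinfun_exp_intertwine) (simp add: blinfun_compose_bilinear_simps z'_z[OF t t])
      have comm: "R t (D x) = D (R t x)" "R t (S x) = S (R t x)" for x
        using R_comm[of D t] R_comm[of S t] SD t by (metis blinfun_apply_blinfun_compose)+
      have Rx: "R t x = R t (R t x) - (1 - t\<^sup>2) *\<^sub>R D (R t (R t x))" for x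
        using RT(2)[OF t, of "R t x"] by (simp add: T_def blinfun.bilinear_simps)
      have "(M t o\<^sub>L - (R t o\<^sub>L (2 * t) *\<^sub>R D o\<^sub>L R t)) + ((2 *\<^sub>R S - (2 * t) *\<^sub>R D) o\<^sub>L R t)
          + (- (2 *\<^sub>R z' t) o\<^sub>L M t o\<^sub>L R t) = 0"
      proof (rule blinfun_eqI)
        fix x
        \<comment> \<open>Expressing \<open>R t x\<close> through \<open>y\<close> clears the
          inverses: a polynomial identity in \<open>S\<close> and \<open>D\<close> remains, settled
          by \<open>SDx\<close> after pairing with a test vector.\<close>
        define y where "y = R t (R t x)"
        have y: "R t x = y - (1 - t\<^sup>2) *\<^sub>R D y" unfolding y_def by (rule Rx)
        have "((M t o\<^sub>L - (R t o\<^sub>L (2 * t) *\<^sub>R D o\<^sub>L R t)) + ((2 *\<^sub>R S - (2 * t) *\<^sub>R D) o\<^sub>L R t)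
            + (- (2 *\<^sub>R z' t) o\<^sub>L M t o\<^sub>L R t)) x
          = - (M t ((2 * t) *\<^sub>R D y)) + (2 *\<^sub>R S (R t x) - (2 * t) *\<^sub>R D (R t x)) - 2 *\<^sub>R S (M t y)"
          by (simp add: blinfun.bilinear_simps comm y_def z'_def M_def algebra_simps)
        also have "\<dots> = 0"
          by (rule vector_eq_rdot[THEN iffD1], rule allI, unfold y)
             (simp add: M_def blinfun.bilinear_simps SDx inner_simps algebra_simps power2_eq_square)
        finally show "((M t o\<^sub>L - (R t o\<^sub>L (2 * t) *\<^sub>R D o\<^sub>L R t)) + ((2 *\<^sub>R S - (2 * t) *\<^sub>R D) o\<^sub>L R t)
            + (- (2 *\<^sub>R z' t) o\<^sub>L M t o\<^sub>L R t)) x = blinfun_apply 0 x" by simp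
      qed
      then have "E t o\<^sub>L ((M t o\<^sub>L - (R t o\<^sub>L (2 * t) *\<^sub>R D o\<^sub>L R t)) + ((2 *\<^sub>R S - (2 * t) *\<^sub>R D) o\<^sub>L R t)
          + (- (2 *\<^sub>R z' t) o\<^sub>L M t o\<^sub>L R t)) = 0" by simp
      then have "(E t o\<^sub>L M t o\<^sub>L - (R t o\<^sub>L (2 * t) *\<^sub>R D o\<^sub>L R t))
          + ((E t o\<^sub>L (2 *\<^sub>R S - (2 * t) *\<^sub>R D)) + ((- (2 *\<^sub>R z' t) o\<^sub>L E t) o\<^sub>L M t) o\<^sub>L R t) = 0"
        by (simp only: blinfun_compose_bilinear_simps E_comm blinfun_compose_assoc add.assoc)
      then show "((\<lambda>t. E t o\<^sub>L M t o\<^sub>L R t) has_vector_derivative 0) (at t within ?I)"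
        by (intro has_vector_derivative_eq_rhs[OF has_vector_derivative_blinfun_compose
              [OF has_vector_derivative_blinfun_compose[OF E'[OF t] M'] R'[OF t]]])
    qed
    also have "M 0 = T 0" by (simp add: M_def T_def)
    then have "E 0 o\<^sub>L M 0 o\<^sub>L R 0 = id_blinfun" using R(2)[of 0]
      by (simp add: blinfun_compose_assoc E_def z_def)
    finally show ?thesis .
  qed
  have exp_z: "blinfun_exp (2 *\<^sub>R z t) = M t o\<^sub>L R t" if "t \<in> ?I" for t
    using W[OF that] blinfun_exp_minus[of "2 *\<^sub>R z t"] unfolding E_def
    by (metis blinfun_compose_assoc blinfun_compose_id)
  have "R 1 = id_blinfun" using R(1)[of 1] by (simp add: T_def)
  then have exp1: "blinfun_exp (2 *\<^sub>R z 1) = id_blinfun - 2 *\<^sub>R D + 2 *\<^sub>R S"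
    using exp_z[of 1] by (simp add: M_def)

  have not_pi_half: "norm (z t) \<noteq> pi / 2" if t: "t \<in> ?I" for t
  proof
    assume eq: "norm (z t) = pi / 2"
    \<comment> \<open>\<open>K\<close> is the conjugate of
      \<open>T t + M t = 2 I - 2 D + 2 t S\<close>, so their product is \<open>4 T 0 (T t)\<close>.
      Hence \<open>R 0 o K\<close> recovers \<open>4 x\<close> from
      \<open>x + exp (2 z t) x\<close>, which bounds the latter below. The summand 1 in
      \<open>k\<close> keeps the denominator positive.\<close>
    define K where "K = 2 *\<^sub>R id_blinfun - 2 *\<^sub>R D - (2 * t) *\<^sub>R S"
    define k where "k = 4 / (norm (R 0 o\<^sub>L K) + 1)"
    have pos: "0 < norm (R 0 o\<^sub>L K) + 1" by (simp add: add_nonneg_pos)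
    then have k: "0 < k" by (simp add: k_def)
    have "k * norm x \<le> norm (x + blinfun_exp (2 *\<^sub>R z t) x)" for x
    proof -
      define y where "y = R t x"
      have x: "x = T t y" by (simp add: y_def RT(2)[OF t])
      have "K (x + blinfun_exp (2 *\<^sub>R z t) x) = K (T t y + M t y)"
        using exp_z[OF t] by (simp add: x[symmetric]) (simp add: y_def)
      also have "\<dots> = 4 *\<^sub>R T 0 (T t y)"
        by (rule vector_eq_rdot[THEN iffD1], rule allI)
           (simp add: K_def M_def T_def blinfun.bilinear_simps SDx inner_simps algebra_simps power2_eq_square)
      finally have "(R 0 o\<^sub>L K) (x + blinfun_exp (2 *\<^sub>R z t) x) = 4 *\<^sub>R x"
        by (simp add: RT x[symmetric] blinfun.scaleR_right)
      then have "4 * norm x \<le> norm (R 0 o\<^sub>L K) * norm (x + blinfun_exp (2 *\<^sub>R z t) x)"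
        using norm_blinfun[of "R 0 o\<^sub>L K" "x + blinfun_exp (2 *\<^sub>R z t) x"] by simp
      also have "\<dots> \<le> (norm (R 0 o\<^sub>L K) + 1) * norm (x + blinfun_exp (2 *\<^sub>R z t) x)"
        by (simp add: mult_right_mono)
      finally show ?thesis
        using pos by (simp add: k_def pos_divide_le_eq mult.commute)
    qed
    from skew_norm_less_pi_half[OF z_skew[OF t] _ k this] eq show False by simp
  qed
  \<comment> \<open>\<open>norm (z t)\<close> is continuous and starts at 0, so it cannot reach 1
    above the excluded value \<open>pi / 2\<close>.\<close>
  have "norm (z 1) < pi / 2"
  proof (rule ccontr)
    assume "\<not> ?thesis"
    moreover have "continuous_on ?I (\<lambda>t. norm (z t))"
      using continuous_on_vector_derivative[OF z_deriv] by (rule continuous_on_norm)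
    ultimately have "\<exists>t\<ge>0. t \<le> 1 \<and> norm (z t) = pi / 2"
      by (intro IVT') (simp_all add: z_def)
    then show False using not_pi_half by auto
  qed
  moreover have "b o\<^sub>L z 1 = z 1 o\<^sub>L b" if "b o\<^sub>L S = S o\<^sub>L b" "b o\<^sub>L D = D o\<^sub>L b" for b
    using z_comm[OF z'_comm[OF that]] by simp
  ultimately show thesis using that[of "z 1"] z_skew[of 1] exp1 by simp
qed

text \<open>The bound gives \<open>norm D < 1\<close> for \<open>D = (2 I - g - h) / 4\<close>. A
  rival \<open>w\<close> commutes with \<open>g = exp (2 w)\<close>, so with its inverse
  \<open>h\<close>, with \<open>S\<close> and \<open>D\<close>, and thus with the constructed
  \<open>z\<close>; then \<open>skew_exp_unique\<close> applies.\<close>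

lemma orthogonal_skew_logarithm_unique:
  fixes g h :: "'h::{real_inner,banach} \<Rightarrow>\<^sub>L 'h"
  assumes adj: "blinfun_adjoint g = h" and gh: "g o\<^sub>L h = id_blinfun" and hg: "h o\<^sub>L g = id_blinfun"
    and small: "norm (2 *\<^sub>R id_blinfun - g - h) < 4"
  shows "\<exists>!z. blinfun_adjoint z = - z \<and> norm z < pi / 2 \<and> blinfun_exp (2 *\<^sub>R z) = g"
proof -
  define D where "D = (1/4) *\<^sub>R (2 *\<^sub>R id_blinfun - g - h)"
  define S where "S = (1/4) *\<^sub>R (g - h)"
  have ghx: "g (h x) = x" "h (g x) = x" for x
    using gh hg by (metis blinfun_apply_blinfun_compose blinfun_apply_id_blinfun id_apply)+
  have inner: "g x \<bullet> y = x \<bullet> h y" "h x \<bullet> y = x \<bullet> g y" for x y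
    using adj by (auto simp: blinfun_adjoint_eq_iff) (metis inner_commute)
  have "norm D < 1" using small by (simp add: D_def)
  moreover have "blinfun_adjoint S = - S" "blinfun_adjoint D = D"
    unfolding blinfun_adjoint_eq_iff S_def D_def
    by (simp_all add: blinfun.bilinear_simps inner_simps inner algebra_simps)
  moreover have "S o\<^sub>L D = D o\<^sub>L S"
    by (rule blinfun_eqI) (simp add: S_def D_def blinfun.bilinear_simps ghx algebra_simps)
  moreover have "S o\<^sub>L S = (D o\<^sub>L D) - D"
  proof (rule blinfun_eqI, rule vector_eq_rdot[THEN iffD1], rule allI)
    fix x y
    show "(S o\<^sub>L S) x \<bullet> y = ((D o\<^sub>L D) - D) x \<bullet> y"
      by (simp add: S_def D_def blinfun.bilinear_simps inner_simps ghx field_simps)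
  qed
  ultimately obtain z where z: "blinfun_adjoint z = - z" "norm z < pi / 2"
    "blinfun_exp (2 *\<^sub>R z) = id_blinfun - 2 *\<^sub>R D + 2 *\<^sub>R S"
    and z_comm: "\<And>b. b o\<^sub>L S = S o\<^sub>L b \<Longrightarrow> b o\<^sub>L D = D o\<^sub>L b \<Longrightarrow> b o\<^sub>L z = z o\<^sub>L b"
    using skew_logarithm_exists by blast
  have exp_z: "blinfun_exp (2 *\<^sub>R z) = g"
    unfolding z(3)
    by (rule blinfun_eqI, rule vector_eq_rdot[THEN iffD1], rule allI)
       (simp add: S_def D_def blinfun.bilinear_simps inner_simps field_simps)
  show ?thesis
  proof (rule ex1I[of _ z])
    fix w assume w: "blinfun_adjoint w = - w \<and> norm w < pi / 2 \<and> blinfun_exp (2 *\<^sub>R w) = g"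
    have "w o\<^sub>L blinfun_exp (2 *\<^sub>R w) = blinfun_exp (2 *\<^sub>R w) o\<^sub>L w"
      by (rule blinfun_exp_intertwine) (simp add: blinfun_compose_bilinear_simps)
    with w have wg: "w o\<^sub>L g = g o\<^sub>L w" by simp
    then have wh: "w o\<^sub>L h = h o\<^sub>L w" using gh hg by (metis blinfun_compose_assoc blinfun_compose_id)
    have "w o\<^sub>L z = z o\<^sub>L w"
      by (rule z_comm) (simp_all add: S_def D_def blinfun_compose_bilinear_simps wg wh)
    then show "w = z" using skew_exp_unique[of w z] w z(1,2) exp_z by simp
  qed (use z(1,2) exp_z in simp)
qed

subsection \<open>Geodesics and covariant derivatives\<close>

text \<open>
  The conditions defining the logarithm \<open>z\<close> of \<open>e1 e0\<close> are preserved by \<open>z \<mapsto> - e0 z e0\<close>, so by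
  uniqueness \<open>z\<close> anticommutes with \<open>e0\<close>.
\<close>

lemma short_geodesic_exponent_unique:
  assumes e0: "e0 \<in> Gr" and e1: "e1 \<in> Gr" and small: "norm (e0 - e1) < 2"
  shows "\<exists>!z. short_geodesic_exponent e0 e1 z"
proof -
  have sa: "e0 x \<bullet> y = x \<bullet> e0 y" "e1 x \<bullet> y = x \<bullet> e1 y" for x y
    using e0 e1 by (simp_all add: Gr_def blinfun_adjoint_eq_iff)
  have sq: "e0 (e0 x) = x" "e1 (e1 x) = x" for x
    using e0 e1 unfolding Gr_def
    by (metis (mono_tags, lifting) blinfun_apply_blinfun_compose blinfun_apply_id_blinfun id_apply mem_Collect_eq)+
  define g where "g = e1 o\<^sub>L e0"
  define h where "h = e0 o\<^sub>L e1"
  \<comment> \<open>\<open>g\<close> and \<open>h\<close> are the cross terms of this square, so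
    distance below 2 becomes the bound 4 required for the logarithm of \<open>g\<close>.\<close>
  have "2 *\<^sub>R id_blinfun - g - h = (e0 - e1) o\<^sub>L (e0 - e1)"
    by (rule blinfun_eqI) (simp add: g_def h_def blinfun.bilinear_simps sq scaleR_2)
  then have "norm (2 *\<^sub>R id_blinfun - g - h) \<le> norm (e0 - e1) * norm (e0 - e1)"
    using norm_blinfun_compose by metis
  also have "\<dots> < 2 * 2" using small by (intro mult_strict_mono') auto
  finally have "norm (2 *\<^sub>R id_blinfun - g - h) < 4" by simp
  moreover have "blinfun_adjoint g = h" by (simp add: blinfun_adjoint_eq_iff g_def h_def sa)
  moreover have "g o\<^sub>L h = id_blinfun" "h o\<^sub>L g = id_blinfun"
    by (rule blinfun_eqI, simp add: g_def h_def sq)+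
  ultimately have ex1: "\<exists>!z. blinfun_adjoint z = - z \<and> norm z < pi / 2 \<and> blinfun_exp (2 *\<^sub>R z) = g"
    by (intro orthogonal_skew_logarithm_unique)
  have anti: "z o\<^sub>L e0 = - (e0 o\<^sub>L z)"
    if z: "blinfun_adjoint z = - z" "norm z < pi / 2" "blinfun_exp (2 *\<^sub>R z) = g" for z
  proof -
    define w where "w = - (e0 o\<^sub>L z o\<^sub>L e0)"
    have norm_e0: "norm (e0 x) = norm x" for x
      by (simp add: norm_eq_sqrt_inner sa sq)
    have "blinfun_adjoint w = - w"
      by (simp add: blinfun_adjoint_eq_iff w_def sa blinfun.minus_left skew_inner[OF z(1)])
    moreover have "norm w < pi / 2"
      by (rule le_less_trans[OF norm_blinfun_bound z(2)])
        (simp_all add: w_def blinfun.minus_left norm_e0 order_trans[OF norm_blinfun])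
    moreover have "blinfun_exp (2 *\<^sub>R w) = g"
    proof -
      \<comment> \<open>Conjugation by \<open>e0\<close> turns \<open>- z\<close> into
        \<open>w\<close>, so \<open>exp (2 w) = e0 h e0 = e1 e0 = g\<close>.\<close>
      have "e0 o\<^sub>L blinfun_exp (- (2 *\<^sub>R z)) = blinfun_exp (2 *\<^sub>R w) o\<^sub>L e0"
        by (rule blinfun_exp_intertwine, rule blinfun_eqI)
           (simp add: w_def blinfun.bilinear_simps sq)
      moreover have "blinfun_exp (- (2 *\<^sub>R z)) = h"
        using blinfun_exp_minus[of "2 *\<^sub>R z"] z(3) \<open>h o\<^sub>L g = id_blinfun\<close>
        by (metis blinfun_compose_assoc blinfun_compose_id)
      ultimately have "e0 (h (e0 x)) = blinfun_exp (2 *\<^sub>R w) x" for x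
        by (metis blinfun_apply_blinfun_compose sq(1))
      then show ?thesis
        by (intro blinfun_eqI) (metis g_def h_def sq(1) blinfun_apply_blinfun_compose)
    qed
    ultimately have "w = z" using ex1 z by blast
    then have "z (e0 x) = w (e0 x)" for x by simp
    then show ?thesis by (intro blinfun_eqI) (simp add: w_def blinfun.minus_left sq)
  qed
  have "Gr_geodesic e0 z 1 = e1 \<longleftrightarrow> blinfun_exp (2 *\<^sub>R z) = g" for z
  proof -
    have "blinfun_exp (2 *\<^sub>R z) o\<^sub>L e0 = e1 \<longleftrightarrow> blinfun_exp (2 *\<^sub>R z) = e1 o\<^sub>L e0"
      using e0 by (auto simp: Gr_def blinfun_compose_assoc)
    then show ?thesis by (simp add: Gr_geodesic_def g_def)
  qed
  \<comment> \<open>By \<open>anti\<close>, every small skew logarithm of \<open>g\<close>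
    anticommutes with \<open>e0\<close>, so the exponents are exactly these logarithms.\<close>
  then have "short_geodesic_exponent e0 e1 z \<longleftrightarrow>
      blinfun_adjoint z = - z \<and> norm z < pi / 2 \<and> blinfun_exp (2 *\<^sub>R z) = g" for z
    using anti unfolding short_geodesic_exponent_def by blast
  then show ?thesis using ex1 by simp
qed

section \<open>Lagrangian symmetries and their geodesics\<close>

lemma complex_structure_apply:
  assumes "complex_structure J"
  shows "J (J x) = - x" "J x \<bullet> y = - (x \<bullet> J y)" "norm (J x) = norm x"
proof -
  show JJ: "J (J x) = - x" for x
    using assms unfolding complex_structure_def
    by (metis blinfun.minus_left blinfun_apply_blinfun_compose blinfun_apply_id_blinfun id_apply)
  show Js: "J x \<bullet> y = - (x \<bullet> J y)" for x y
    using assms by (simp add: complex_structure_def skew_inner)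
  show "norm (J x) = norm x" by (simp add: norm_eq_sqrt_inner Js JJ)
qed

lemma Lagr_apply:
  assumes "e \<in> Lagr J"
  shows "e (e x) = x" "e (J x) = - J (e x)" "e x \<bullet> y = x \<bullet> e y"
proof -
  have e: "e o\<^sub>L e = id_blinfun" "e o\<^sub>L J = - (J o\<^sub>L e)" "blinfun_adjoint e = e"
    using assms by (auto simp: Lagr_def Gr_def)
  show "e (e x) = x" "e (J x) = - J (e x)"
    using e(1,2) by (metis blinfun.minus_left blinfun_apply_blinfun_compose blinfun_apply_id_blinfun id_apply)+
  show "e x \<bullet> y = x \<bullet> e y" using e(3) by (simp add: blinfun_adjoint_eq_iff)
qed

text \<open>
  \<open>z \<mapsto> - J z J\<close> preserves the conditions defining the exponent, so by uniqueness the exponent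
  commutes with \<open>J\<close>.
\<close>

lemma short_geodesic_exponent_commute_J:
  assumes J: "complex_structure J" and e0: "e0 \<in> Lagr J" and e1: "e1 \<in> Lagr J"
    and small: "norm (e0 - e1) < 2" and z: "short_geodesic_exponent e0 e1 z"
  shows "z o\<^sub>L J = J o\<^sub>L z"
proof -
  note J' = complex_structure_apply[OF J]
  have z': "blinfun_adjoint z = - z" "z o\<^sub>L e0 = - (e0 o\<^sub>L z)" "norm z < pi / 2"
    "blinfun_exp (2 *\<^sub>R z) o\<^sub>L e0 = e1"
    using z by (auto simp: short_geodesic_exponent_def Gr_geodesic_def)
  have ze0: "z (e0 x) = - e0 (z x)" for x
    using z'(2) by (metis blinfun.minus_left blinfun_apply_blinfun_compose)
  have Je0: "J (e0 x) = - e0 (J x)" for x by (simp add: Lagr_apply(2)[OF e0])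
  define w where "w = - (J o\<^sub>L z o\<^sub>L J)"
  have "blinfun_adjoint w = - w"
    by (simp add: blinfun_adjoint_eq_iff w_def J' blinfun.bilinear_simps skew_inner[OF z'(1)])
  moreover have "w o\<^sub>L e0 = - (e0 o\<^sub>L w)"
    by (rule blinfun_eqI)
       (simp add: w_def blinfun.bilinear_simps ze0 Je0)
  moreover have "norm w < pi / 2"
  proof (rule le_less_trans[OF _ z'(3)], rule norm_blinfun_bound)
    show "norm (w x) \<le> norm z * norm x" for x
      using norm_blinfun[of z "J x"] by (simp add: w_def blinfun.minus_left J')
  qed simp
  moreover have "blinfun_exp (2 *\<^sub>R w) o\<^sub>L e0 = e1"
  proof (rule blinfun_eqI)
    fix x
    have "J o\<^sub>L blinfun_exp (2 *\<^sub>R z) = blinfun_exp (2 *\<^sub>R w) o\<^sub>L J"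
      by (rule blinfun_exp_intertwine, rule blinfun_eqI)
         (simp add: w_def blinfun.bilinear_simps J')
    then have w_J: "blinfun_exp (2 *\<^sub>R w) (J y) = J (blinfun_exp (2 *\<^sub>R z) y)" for y
      by (metis blinfun_apply_blinfun_compose)
    \<comment> \<open>Anticommutation and \<open>J^2 = - I\<close> give \<open>e0 = J e0 J\<close>;
      the left \<open>J\<close> passes through the exponential, turning \<open>w\<close> into
      \<open>z\<close>, and \<open>J e1 J = e1\<close> finishes.\<close>
    have "(blinfun_exp (2 *\<^sub>R w) o\<^sub>L e0) x = blinfun_exp (2 *\<^sub>R w) (J (e0 (J x)))"
      by (simp add: Lagr_apply(2)[OF e0] J' blinfun.bilinear_simps)
    also have "\<dots> = J (e1 (J x))"
      unfolding w_J using z'(4) by (metis blinfun_apply_blinfun_compose)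
    also have "\<dots> = e1 x" by (simp add: Lagr_apply(2)[OF e1] J' blinfun.bilinear_simps)
    finally show "(blinfun_exp (2 *\<^sub>R w) o\<^sub>L e0) x = e1 x" .
  qed
  ultimately have "short_geodesic_exponent e0 e1 w"
    by (simp add: short_geodesic_exponent_def Gr_geodesic_def)
  then have "w = z"
    using short_geodesic_exponent_unique[OF _ _ small] z e0 e1 by (auto simp: Lagr_def)
  then have "z (J x) = w (J x)" for x by simp
  then show ?thesis by (intro blinfun_eqI) (simp add: w_def J' blinfun.bilinear_simps)
qed

text \<open>Moving \<open>e0\<close> past the exponential inverts it, which makes the product
  self-adjoint and involutive. The exponential commutes with \<open>J\<close> while
  \<open>e0\<close> anticommutes, so the product anticommutes.\<close>

lemma Gr_geodesic_in_Lagr: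
  assumes J: "complex_structure J" and e0: "e0 \<in> Lagr J"
    and skew: "blinfun_adjoint z = - z" and anti: "z o\<^sub>L e0 = - (e0 o\<^sub>L z)" and comm: "z o\<^sub>L J = J o\<^sub>L z"
  shows "Gr_geodesic e0 z t \<in> Lagr J"
proof -
  let ?a = "(2 * t) *\<^sub>R z"
  note e0' = Lagr_apply[OF e0]
  have "e0 o\<^sub>L blinfun_exp ?a = blinfun_exp (- ?a) o\<^sub>L e0" "J o\<^sub>L blinfun_exp ?a = blinfun_exp ?a o\<^sub>L J"
    by (rule blinfun_exp_intertwine, simp add: blinfun_compose_bilinear_simps anti comm)+
  then have ee: "e0 (blinfun_exp ?a x) = blinfun_exp (- ?a) (e0 x)"
    and eJ: "J (blinfun_exp ?a x) = blinfun_exp ?a (J x)" for x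
    by (metis blinfun_apply_blinfun_compose)+
  have adj: "blinfun_exp ?a x \<bullet> y = x \<bullet> blinfun_exp (- ?a) y" for x y
    using blinfun_adjoint_exp[of ?a] by (simp add: skew_scaleR[OF skew] blinfun_adjoint_eq_iff)
  have ee': "blinfun_exp (- ?a) (e0 x) = e0 (blinfun_exp ?a x)" for x by (simp add: ee)
  have e'e: "e0 (blinfun_exp (- ?a) x) = blinfun_exp ?a (e0 x)" for x
    by (metis blinfun_exp_minus_apply(2) e0'(1) ee)
  show ?thesis
    unfolding Lagr_def Gr_def Gr_geodesic_def
  proof (intro CollectI conjI)
    show "blinfun_adjoint (blinfun_exp ?a o\<^sub>L e0) = blinfun_exp ?a o\<^sub>L e0"
      by (simp add: blinfun_adjoint_eq_iff adj e0'(3) e'e)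
    show "(blinfun_exp ?a o\<^sub>L e0) o\<^sub>L (blinfun_exp ?a o\<^sub>L e0) = id_blinfun"
      by (rule blinfun_eqI) (simp add: ee e0'(1))
    show "blinfun_exp ?a o\<^sub>L e0 o\<^sub>L J = - (J o\<^sub>L (blinfun_exp ?a o\<^sub>L e0))"
      by (rule blinfun_eqI) (simp add: e0'(2) eJ blinfun.bilinear_simps)
  qed
qed

section \<open>Tangency of the covariant derivative\<close>

lemma has_vector_derivative_linear_zero:
  assumes L: "bounded_linear L" and X: "(X has_vector_derivative X') (at t within I)"
    and nontrivial: "at t within I \<noteq> bot" and t: "t \<in> I" and zero: "\<And>s. s \<in> I \<Longrightarrow> L (X s) = 0"
  shows "L X' = 0"
proof (rule vector_derivative_unique_within[OF nontrivial])
  show "((\<lambda>s. L (X s)) has_vector_derivative L X') (at t within I)"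
    by (rule bounded_linear.has_vector_derivative[OF L X])
  show "((\<lambda>s. L (X s)) has_vector_derivative 0) (at t within I)"
    by (rule has_vector_derivative_transform[OF t _ has_vector_derivative_const]) (simp add: zero)
qed

text \<open>Passing \<open>J\<close> through \<open>e a e\<close> changes the sign three times and
  through \<open>a\<close> once, so both terms of the projection anticommute with
  \<open>J\<close>.\<close>

lemma Gr_proj_in_Lagr_tangent:
  assumes e: "e \<in> Lagr J" and a: "blinfun_adjoint a = a" "a o\<^sub>L J = - (J o\<^sub>L a)"
  shows "Gr_proj e a \<in> Lagr_tangent J e"
proof -
  note e' = Lagr_apply[OF e]
  have aJ: "a (J x) = - J (a x)" for x
    using a(2) by (metis blinfun.minus_left blinfun_apply_blinfun_compose)
  have aa: "a x \<bullet> y = x \<bullet> a y" for x y using a(1) by (simp add: blinfun_adjoint_eq_iff)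
  show ?thesis
    unfolding Lagr_tangent_def Gr_tangent_def Gr_proj_def
  proof (intro CollectI conjI)
    show "blinfun_adjoint ((1/2) *\<^sub>R (a - (e o\<^sub>L a o\<^sub>L e))) = (1/2) *\<^sub>R (a - (e o\<^sub>L a o\<^sub>L e))"
      by (simp add: blinfun_adjoint_eq_iff blinfun.bilinear_simps inner_simps aa e'(3))
    show "(1/2) *\<^sub>R (a - (e o\<^sub>L a o\<^sub>L e)) o\<^sub>L e = - (e o\<^sub>L (1/2) *\<^sub>R (a - (e o\<^sub>L a o\<^sub>L e)))"
      by (rule blinfun_eqI) (simp add: blinfun.bilinear_simps e' algebra_simps)
    show "(1/2) *\<^sub>R (a - (e o\<^sub>L a o\<^sub>L e)) o\<^sub>L J = - (J o\<^sub>L (1/2) *\<^sub>R (a - (e o\<^sub>L a o\<^sub>L e)))"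
      by (rule blinfun_eqI) (simp add: blinfun.bilinear_simps e'(1,2) aJ algebra_simps)
  qed
qed

text \<open>Symmetry and anticommutation with \<open>J\<close> are linear conditions independent of
  the time, so they pass from \<open>X\<close> to its derivative. Anticommutation with
  \<open>\<gamma> t\<close> varies with \<open>t\<close> and is restored by the projection.\<close>

lemma covariant_derivative_in_Lagr_tangent:
  fixes J :: "'h::{real_inner,banach} \<Rightarrow>\<^sub>L 'h"
  assumes I: "is_interval I" "interior I \<noteq> {}" and X: "smooth_curve_on I X" and t: "t \<in> I"
    and e: "\<gamma> t \<in> Lagr J" and tangent: "\<And>s. s \<in> I \<Longrightarrow> X s \<in> Lagr_tangent J (\<gamma> s)"
  shows "covariant_derivative I \<gamma> X t \<in> Lagr_tangent J (\<gamma> t)"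
proof -
  \<comment> \<open>An interval with interior has no isolated point, so derivatives within
    \<open>I\<close> are unique, also at end points, and \<open>vector_derivative\<close> has the
    value \<open>a\<close>.\<close>
  have "\<not> (\<exists>a. I = {a})" using I(2) by auto
  then have "t islimpt I"
    using t I(1) by (intro connected_imp_perfect) (auto simp: is_interval_connected_1)
  then have nt: "at t within I \<noteq> bot" by (simp add: trivial_limit_within)
  obtain D where D: "\<And>s. s \<in> I \<Longrightarrow> D 0 s = X s"
    "\<And>n s. s \<in> I \<Longrightarrow> (D n has_vector_derivative D (Suc n) s) (at s within I)"
    using X unfolding smooth_curve_on_def by blast
  define a where "a = D 1 t"
  have a: "(X has_vector_derivative a) (at t within I)"
    using has_vector_derivative_transform[OF t D(1)[symmetric] D(2)[OF t, of 0]] by (simp add: a_def)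
  have "a x \<bullet> y - x \<bullet> a y = 0" for x y
  proof (rule has_vector_derivative_linear_zero[OF _ a nt t])
    show "bounded_linear (\<lambda>a :: 'h \<Rightarrow>\<^sub>L 'h. a x \<bullet> y - x \<bullet> a y)"
      by (intro bounded_linear_sub bounded_linear_intros)
  qed (use tangent in \<open>auto simp: Lagr_tangent_def Gr_tangent_def blinfun_adjoint_eq_iff\<close>)
  moreover have "(a o\<^sub>L J) + (J o\<^sub>L a) = 0"
  proof (rule has_vector_derivative_linear_zero[OF _ a nt t])
    show "bounded_linear (\<lambda>a. (a o\<^sub>L J) + (J o\<^sub>L a))"
      by (intro bounded_linear_add bounded_bilinear.bounded_linear_right
          bounded_bilinear.bounded_linear_left bounded_bilinear_blinfun_compose)
  qed (use tangent in \<open>auto simp: Lagr_tangent_def\<close>)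
  ultimately have "Gr_proj (\<gamma> t) a \<in> Lagr_tangent J (\<gamma> t)"
    by (intro Gr_proj_in_Lagr_tangent e) (simp_all add: blinfun_adjoint_eq_iff eq_neg_iff_add_eq_0)
  then show ?thesis
    by (simp add: covariant_derivative_def vector_derivative_within[OF nt a])
qed

theorem proposition2p3:
  fixes J :: "'h::{real_inner,banach} \<Rightarrow>\<^sub>L 'h"
  assumes "complex_structure J"
  shows "(\<forall>(I :: real set) (\<gamma> :: real \<Rightarrow> 'h \<Rightarrow>\<^sub>L 'h) (X :: real \<Rightarrow> 'h \<Rightarrow>\<^sub>L 'h).
            is_interval I \<and> interior I \<noteq> {} \<and>
            smooth_curve_on I \<gamma> \<and> (\<forall>t\<in>I. \<gamma> t \<in> Lagr J) \<and>
            smooth_curve_on I X \<and> (\<forall>t\<in>I. X t \<in> Lagr_tangent J (\<gamma> t)) \<longrightarrow>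
            (\<forall>t\<in>I. covariant_derivative I \<gamma> X t \<in> Lagr_tangent J (\<gamma> t)))
       \<and> (\<forall>\<epsilon>\<^sub>0\<in>Lagr J. \<forall>\<epsilon>\<^sub>1\<in>Lagr J. norm (\<epsilon>\<^sub>0 - \<epsilon>\<^sub>1) < 2 \<longrightarrow>
            (\<exists>!z. short_geodesic_exponent \<epsilon>\<^sub>0 \<epsilon>\<^sub>1 z) \<and>
            (\<forall>z. short_geodesic_exponent \<epsilon>\<^sub>0 \<epsilon>\<^sub>1 z \<longrightarrow>
               (\<forall>t\<in>{0..1}. Gr_geodesic \<epsilon>\<^sub>0 z t \<in> Lagr J)))"
proof (intro conjI allI ballI impI)
  fix \<epsilon>\<^sub>0 \<epsilon>\<^sub>1 :: "'h \<Rightarrow>\<^sub>L 'h"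
  assume e: "\<epsilon>\<^sub>0 \<in> Lagr J" "\<epsilon>\<^sub>1 \<in> Lagr J" "norm (\<epsilon>\<^sub>0 - \<epsilon>\<^sub>1) < 2"
  then show "\<exists>!z. short_geodesic_exponent \<epsilon>\<^sub>0 \<epsilon>\<^sub>1 z"
    by (intro short_geodesic_exponent_unique) (auto simp: Lagr_def)
  fix z t assume "short_geodesic_exponent \<epsilon>\<^sub>0 \<epsilon>\<^sub>1 z"
  then show "Gr_geodesic \<epsilon>\<^sub>0 z t \<in> Lagr J"
    using short_geodesic_exponent_commute_J[OF assms e]
    by (intro Gr_geodesic_in_Lagr[OF assms e(1)]) (auto simp: short_geodesic_exponent_def)
next
  fix I \<gamma> X t
  assume "is_interval I \<and> interior I \<noteq> {} \<and>
    smooth_curve_on I \<gamma> \<and> (\<forall>t\<in>I. \<gamma> t \<in> Lagr J) \<and>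
    smooth_curve_on I X \<and> (\<forall>t\<in>I. X t \<in> Lagr_tangent J (\<gamma> t))" and "t \<in> I"
  then show "covariant_derivative I \<gamma> X t \<in> Lagr_tangent J (\<gamma> t)"
    by (intro covariant_derivative_in_Lagr_tangent) simp_all
qed

end
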